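(* Let $n\ge 4$ and let $\rho:B_n\to GL_n(\mathbb{C})$ be an irreducible representation. Suppose that $\rho(\sigma_1)=1+A_1$ with $\operatorname{rank}(A_1)=2$, and that the friendship graph of $\rho$ is a chain. Then $\rho$ is equivalent to a specialization $\tau_n(u)$ of the standard representation for some $u\in\mathbb{C}^*$.
   Context: $B_n$ is the Artin braid group on $n$ strings, $B_n=\langle \sigma_1,\dots,\sigma_{n-1}\mid \sigma_i\sigma_{i+1}\sigma_i=\sigma_{i+1}\sigma_i\sigma_{i+1}\ (1\le i\le n-2),\ \sigma_i\sigma_j=\sigma_j\sigma_i\ (|i-j|\ge 2)\rangle$. For a representation $\rho$ of $B_n$ with $\rho(\sigma_i)=1+A_i$, the friendship graph of $\rho$ is the simple graph with vertices $A_1,\dots,A_{n-1}$ (one vertex for each index) in which $A_i$ and $A_j$ ($i\ne j$) are joined by an edge if and only if $\operatorname{Im}(A_i)\cap\operatorname{Im}(A_j)\ne\{0\}$. The friendship graph is a chain if $A_i$ and $A_j$ are joined by an edge exactly when $|i-j|=1$. The standard representation $\tau_n:B_n\to GL_n(\mathbb{Z}[t^{\pm1}])$ is defined by $$\tau_n(\sigma_i)=\begin{pmatrix} I_{i-1}&&&\\ &0&t&\\ &1&0&\\ &&&I_{n-1-i}\end{pmatrix},\quad i=1,\dots,n-1,$$ where $I_k$ is the $k\times k$ identity matrix and the block $\begin{pmatrix}0&t\\1&0\end{pmatrix}$ occupies rows and columns $i,i+1$. For $u\in\mathbb{C}^*$, $\tau_n(u):B_n\to GL_n(\mathbb{C})$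 is the specialization $t=u$. Two representations are equivalent if they are conjugate by an invertible complex matrix. *)

theory Defs
  imports Complex_Main "HOL-Algebra.Coset" "Jordan_Normal_Form.DL_Rank"
begin

section \<open>Groups given by generators and relations\<close>

text \<open>A letter \<open>(s, True)\<close> stands for the generator \<open>s\<close>, and \<open>(s, False)\<close> for its inverse.\<close>

type_synonym 'a gword = "('a \<times> bool) list"

definition gwords :: "'a set \<Rightarrow> 'a gword set" where
  "gwords S = lists (S \<times> UNIV)"

text \<open>The congruence on words generated by the relations \<open>R\<close> and free cancellation.\<close>

inductive_set pres_cong :: "'a set \<Rightarrow> ('a gword \<times> 'a gword) set \<Rightarrow> ('a gword \<times> 'a gword) set"
  for S R where
    refl: "w \<in> gwords S \<Longrightarrow> (w, w) \<in> pres_cong S R"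
  | sym: "(v, w) \<in> pres_cong S R \<Longrightarrow> (w, v) \<in> pres_cong S R"
  | trans: "(u, v) \<in> pres_cong S R \<Longrightarrow> (v, w) \<in> pres_cong S R \<Longrightarrow> (u, w) \<in> pres_cong S R"
  | append: "(v, w) \<in> pres_cong S R \<Longrightarrow> (v', w') \<in> pres_cong S R \<Longrightarrow> (v @ v', w @ w') \<in> pres_cong S R"
  | cancel: "s \<in> S \<Longrightarrow> ([(s, b), (s, \<not> b)], []) \<in> pres_cong S R"
  | relation: "(v, w) \<in> R \<Longrightarrow> v \<in> gwords S \<Longrightarrow> w \<in> gwords S \<Longrightarrow> (v, w) \<in> pres_cong S R"

definition presented_group :: "'a set \<Rightarrow> ('a gword \<times> 'a gword) set \<Rightarrow> 'a gword set monoid" where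
  "presented_group S R = \<lparr>
     carrier = gwords S // pres_cong S R,
     mult = (\<lambda>X Y. \<Union>x\<in>X. \<Union>y\<in>Y. pres_cong S R `` {x @ y}),
     one = pres_cong S R `` {[]} \<rparr>"

definition presented_gen :: "'a set \<Rightarrow> ('a gword \<times> 'a gword) set \<Rightarrow> 'a \<Rightarrow> 'a gword set" where
  "presented_gen S R s = pres_cong S R `` {[(s, True)]}"

fun word_eval :: "('b, 'c) monoid_scheme \<Rightarrow> ('a \<Rightarrow> 'b) \<Rightarrow> 'a gword \<Rightarrow> 'b" where
  "word_eval G f [] = \<one>\<^bsub>G\<^esub>"
| "word_eval G f ((s, b) # w) = (if b then f s else inv\<^bsub>G\<^esub> (f s)) \<otimes>\<^bsub>G\<^esub> word_eval G f w"

text \<open>The homomorphism to \<open>G\<close> sending each generator \<open>s\<close> to \<open>f s\<close>. It is well defined if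
  the values \<open>f s\<close> satisfy the relations, see \<open>presented_lift_hom\<close> and
  \<open>presented_lift_gen\<close> below.\<close>

definition presented_lift :: "('b, 'c) monoid_scheme \<Rightarrow> ('a \<Rightarrow> 'b) \<Rightarrow> 'a gword set \<Rightarrow> 'b" where
  "presented_lift G f X = the_elem (word_eval G f ` X)"

lemma gwords_simps [simp]:
  "[] \<in> gwords S" "x # w \<in> gwords S \<longleftrightarrow> fst x \<in> S \<and> w \<in> gwords S"
  "v @ w \<in> gwords S \<longleftrightarrow> v \<in> gwords S \<and> w \<in> gwords S"
  by (auto simp: gwords_def mem_Times_iff)

lemma pres_cong_gwords: "(v, w) \<in> pres_cong S R \<Longrightarrow> v \<in> gwords S \<and> w \<in> gwords S"
  by (induction rule: pres_cong.induct) auto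

lemma equiv_pres_cong: "equiv (gwords S) (pres_cong S R)"
proof (rule equivI)
  show "pres_cong S R \<subseteq> gwords S \<times> gwords S" using pres_cong_gwords by auto
  show "refl_on (gwords S) (pres_cong S R)"
    by (auto intro!: refl_onI pres_cong.refl)
  show "Relation.sym (pres_cong S R)" by (rule symI) (rule pres_cong.sym)
  show "Relation.trans (pres_cong S R)" by (rule transI) (rule pres_cong.trans)
qed

lemma presented_mult:
  assumes "v \<in> gwords S" "w \<in> gwords S"
  shows "pres_cong S R `` {v} \<otimes>\<^bsub>presented_group S R\<^esub> pres_cong S R `` {w} = pres_cong S R `` {v @ w}"
proof -
  have "congruent2 (pres_cong S R) (pres_cong S R) (\<lambda>x y. pres_cong S R `` {x @ y})"
    by (auto simp: congruent2_def intro!: equiv_class_eq[OF equiv_pres_cong] pres_cong.append)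
  from UN_equiv_class2[OF equiv_pres_cong equiv_pres_cong this assms]
  show ?thesis by (simp add: presented_group_def)
qed

lemma presented_carrierE:
  assumes "X \<in> carrier (presented_group S R)"
  obtains w where "w \<in> gwords S" "X = pres_cong S R `` {w}"
  using assms by (auto simp: presented_group_def elim: quotientE)

lemma presented_carrierI [intro]:
  "w \<in> gwords S \<Longrightarrow> pres_cong S R `` {w} \<in> carrier (presented_group S R)"
  by (auto simp: presented_group_def intro: quotientI)

lemma presented_one: "\<one>\<^bsub>presented_group S R\<^esub> = pres_cong S R `` {[]}"
  by (simp add: presented_group_def)

lemma presented_inv_ex:
  "w \<in> gwords S \<Longrightarrow> \<exists>v \<in> gwords S. (v @ w, []) \<in> pres_cong S R"
proof (induction w)
  case Nil
  then show ?case by (intro bexI[of _ "[]"]) (auto intro: pres_cong.refl)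
next
  case (Cons x w)
  obtain s b where x: "x = (s, b)" by (cases x)
  from Cons x obtain v where v: "v \<in> gwords S" "(v @ w, []) \<in> pres_cong S R" and s: "s \<in> S"
    and w: "w \<in> gwords S" by auto
  have "([(s, \<not> b), (s, b)] @ w, [] @ w) \<in> pres_cong S R"
    using pres_cong.cancel[OF s, of "\<not> b"] w by (intro pres_cong.append pres_cong.refl) auto
  then have "(v @ [(s, \<not> b), (s, b)] @ w, v @ [] @ w) \<in> pres_cong S R"
    using v by (intro pres_cong.append[of v v] pres_cong.refl) auto
  then have "((v @ [(s, \<not> b)]) @ x # w, []) \<in> pres_cong S R"
    using pres_cong.trans[OF _ v(2)] x by simp
  then show ?case using v s by (intro bexI[of _ "v @ [(s, \<not> b)]"]) auto
qed

lemma group_presented: "group (presented_group S R)"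
proof (rule groupI)
  fix x y assume "x \<in> carrier (presented_group S R)" "y \<in> carrier (presented_group S R)"
  then show "x \<otimes>\<^bsub>presented_group S R\<^esub> y \<in> carrier (presented_group S R)"
    by (elim presented_carrierE) (auto simp: presented_mult)
next
  show "\<one>\<^bsub>presented_group S R\<^esub> \<in> carrier (presented_group S R)"
    by (auto simp: presented_one)
next
  fix x y z assume "x \<in> carrier (presented_group S R)" "y \<in> carrier (presented_group S R)"
    "z \<in> carrier (presented_group S R)"
  then show "x \<otimes>\<^bsub>presented_group S R\<^esub> y \<otimes>\<^bsub>presented_group S R\<^esub> z =
     x \<otimes>\<^bsub>presented_group S R\<^esub> (y \<otimes>\<^bsub>presented_group S R\<^esub> z)"
    by (elim presented_carrierE) (auto simp: presented_mult)
next
  fix x assume "x \<in> carrier (presented_group S R)"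
  then show "\<one>\<^bsub>presented_group S R\<^esub> \<otimes>\<^bsub>presented_group S R\<^esub> x = x"
    by (elim presented_carrierE) (auto simp: presented_mult presented_one)
next
  fix x assume "x \<in> carrier (presented_group S R)"
  then obtain w where w: "w \<in> gwords S" "x = pres_cong S R `` {w}" by (rule presented_carrierE)
  from presented_inv_ex[OF w(1)] obtain v where v: "v \<in> gwords S" "(v @ w, []) \<in> pres_cong S R"
    by blast
  then have "pres_cong S R `` {v} \<otimes>\<^bsub>presented_group S R\<^esub> x = \<one>\<^bsub>presented_group S R\<^esub>"
    using w equiv_class_eq[OF equiv_pres_cong v(2)] by (simp add: presented_mult presented_one)
  then show "\<exists>y\<in>carrier (presented_group S R). y \<otimes>\<^bsub>presented_group S R\<^esub> x = \<one>\<^bsub>presented_group S R\<^esub>"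
    using v by blast
qed

lemma word_eval_closed:
  assumes "group G" "\<And>s. s \<in> S \<Longrightarrow> f s \<in> carrier G" "w \<in> gwords S"
  shows "word_eval G f w \<in> carrier G"
proof -
  interpret group G by fact
  show ?thesis using assms(3) by (induction w) (auto simp: assms(2))
qed

lemma word_eval_append:
  assumes "group G" "\<And>s. s \<in> S \<Longrightarrow> f s \<in> carrier G" "v \<in> gwords S" "w \<in> gwords S"
  shows "word_eval G f (v @ w) = word_eval G f v \<otimes>\<^bsub>G\<^esub> word_eval G f w"
proof -
  interpret group G by fact
  note cl = word_eval_closed[OF assms(1,2)]
  show ?thesis using assms(3,4) by (induction v) (auto simp: assms(2) cl m_assoc)
qed

lemma word_eval_cong:
  assumes "group G" "\<And>s. s \<in> S \<Longrightarrow> f s \<in> carrier G"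
    and "\<And>v w. (v, w) \<in> R \<Longrightarrow> word_eval G f v = word_eval G f w"
    and "(v, w) \<in> pres_cong S R"
  shows "word_eval G f v = word_eval G f w"
proof -
  interpret group G by fact
  show ?thesis using assms(4)
  proof (induction rule: pres_cong.induct)
    case (append v w v' w')
    have "word_eval G f (v @ v') = word_eval G f v \<otimes>\<^bsub>G\<^esub> word_eval G f v'"
      "word_eval G f (w @ w') = word_eval G f w \<otimes>\<^bsub>G\<^esub> word_eval G f w'"
      using pres_cong_gwords[OF append.hyps(1)] pres_cong_gwords[OF append.hyps(2)]
      by (simp_all add: word_eval_append[where S = S, OF assms(1,2)])
    then show ?case by (simp only: append.IH)
  next
    case (cancel s b)
    then show ?case using assms(2)[of s] by auto
  next
    case (relation v w)
    then show ?case by (intro assms(3))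
  qed auto
qed

lemma presented_lift_class:
  assumes "group G" "\<And>s. s \<in> S \<Longrightarrow> f s \<in> carrier G"
    and "\<And>v w. (v, w) \<in> R \<Longrightarrow> word_eval G f v = word_eval G f w"
    and "w \<in> gwords S"
  shows "presented_lift G f (pres_cong S R `` {w}) = word_eval G f w"
proof -
  have "word_eval G f v = word_eval G f w" if "v \<in> pres_cong S R `` {w}" for v
    using word_eval_cong[where S = S and R = R, OF assms(1-3)] that by (metis Image_singleton_iff)
  moreover have "w \<in> pres_cong S R `` {w}"
    using pres_cong.refl[OF assms(4), of R] by simp
  ultimately have "word_eval G f ` (pres_cong S R `` {w}) = {word_eval G f w}"
    by blast
  then show ?thesis by (simp add: presented_lift_def)
qed

lemma presented_lift_hom:
  assumes "group G" "\<And>s. s \<in> S \<Longrightarrow> f s \<in> carrier G"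
    and "\<And>v w. (v, w) \<in> R \<Longrightarrow> word_eval G f v = word_eval G f w"
  shows "presented_lift G f \<in> hom (presented_group S R) G"
proof -
  note lift = presented_lift_class[OF assms]
  show ?thesis
  proof (rule homI)
    fix x assume "x \<in> carrier (presented_group S R)"
    then show "presented_lift G f x \<in> carrier G"
      by (elim presented_carrierE) (auto simp: lift intro!: word_eval_closed[OF assms(1,2)])
  next
    fix x y assume "x \<in> carrier (presented_group S R)" "y \<in> carrier (presented_group S R)"
    then show "presented_lift G f (x \<otimes>\<^bsub>presented_group S R\<^esub> y) =
        presented_lift G f x \<otimes>\<^bsub>G\<^esub> presented_lift G f y"
      by (elim presented_carrierE)
         (auto simp: lift presented_mult intro!: word_eval_append[OF assms(1,2)])
  qed
qed

lemma presented_lift_gen: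
  assumes "group G" "\<And>s. s \<in> S \<Longrightarrow> f s \<in> carrier G"
    and "\<And>v w. (v, w) \<in> R \<Longrightarrow> word_eval G f v = word_eval G f w" and "s \<in> S"
  shows "presented_lift G f (presented_gen S R s) = f s"
proof -
  interpret group G by fact
  show ?thesis unfolding presented_gen_def
    using assms(2,4) by (subst presented_lift_class[OF assms(1-3)]) auto
qed

section \<open>Braid groups\<close>

definition braid_relations :: "nat \<Rightarrow> (nat gword \<times> nat gword) set" where
  "braid_relations n =
     {([(i, True), (Suc i, True), (i, True)], [(Suc i, True), (i, True), (Suc i, True)]) | i.
        i \<in> {1..n-2}} \<union>
     {([(i, True), (j, True)], [(j, True), (i, True)]) | i j.
        i \<in> {1..n-1} \<and> j \<in> {1..n-1} \<and> \<bar>int i - int j\<bar> \<ge> 2}"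

definition braid_group :: "nat \<Rightarrow> nat gword set monoid" where
  "braid_group n = presented_group {1..n-1} (braid_relations n)"

definition braid_gen :: "nat \<Rightarrow> nat \<Rightarrow> nat gword set" where
  "braid_gen n i = presented_gen {1..n-1} (braid_relations n) i"

section \<open>Complex matrix representations\<close>

definition GL :: "nat \<Rightarrow> complex mat monoid" where
  "GL d = units_of (ring_mat TYPE(complex) d ())"

definition representation :: "('g, 'b) monoid_scheme \<Rightarrow> nat \<Rightarrow> ('g \<Rightarrow> complex mat) \<Rightarrow> bool" where
  "representation G d \<rho> \<longleftrightarrow> \<rho> \<in> hom G (GL d)"

definition irreducible_rep :: "('g, 'b) monoid_scheme \<Rightarrow> nat \<Rightarrow> ('g \<Rightarrow> complex mat) \<Rightarrow> bool" where
  "irreducible_rep G d \<rho> \<longleftrightarrow> representation G d \<rho> \<and> d > 0 \<and>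
     (\<forall>W. VectorSpace.subspace class_ring W (module_vec TYPE(complex) d) \<longrightarrow>
          (\<forall>g\<in>carrier G. \<forall>w\<in>W. \<rho> g *\<^sub>v w \<in> W) \<longrightarrow>
          W = {0\<^sub>v d} \<or> W = carrier_vec d)"

definition equivalent_reps ::
    "('g, 'b) monoid_scheme \<Rightarrow> nat \<Rightarrow> ('g \<Rightarrow> complex mat) \<Rightarrow> ('g \<Rightarrow> complex mat) \<Rightarrow> bool" where
  "equivalent_reps G d \<rho> \<rho>' \<longleftrightarrow>
     (\<exists>P\<in>carrier (GL d). \<forall>g\<in>carrier G. \<rho> g = P \<otimes>\<^bsub>GL d\<^esub> \<rho>' g \<otimes>\<^bsub>GL d\<^esub> inv\<^bsub>GL d\<^esub> P)"

lemma group_GL: "group (GL d)"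
proof -
  interpret ring "ring_mat TYPE(complex) d ()" by (rule ring_mat)
  show ?thesis unfolding GL_def by (rule units_group)
qed

lemma GL_simps:
  "carrier (GL d) = Units (ring_mat TYPE(complex) d ())"
  "x \<otimes>\<^bsub>GL d\<^esub> y = x * y" "\<one>\<^bsub>GL d\<^esub> = 1\<^sub>m d"
  by (simp_all add: GL_def units_of_def ring_mat_simps)

lemma GL_carrier_mat: "x \<in> carrier (GL d) \<Longrightarrow> x \<in> carrier_mat d d"
  by (simp add: GL_simps Units_def ring_mat_simps)

lemma GL_carrierI:
  assumes "A \<in> carrier_mat d d" "B \<in> carrier_mat d d" "A * B = 1\<^sub>m d" "B * A = 1\<^sub>m d"
  shows "A \<in> carrier (GL d)"
  using assms by (auto simp: GL_simps Units_def ring_mat_simps)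

section \<open>Friendship graphs\<close>

text \<open>The matrix $A_i$ with $\rho(\sigma_i) = 1 + A_i$.\<close>

definition gen_shift :: "nat \<Rightarrow> nat \<Rightarrow> (nat gword set \<Rightarrow> complex mat) \<Rightarrow> nat \<Rightarrow> complex mat" where
  "gen_shift n d \<rho> i = \<rho> (braid_gen n i) - 1\<^sub>m d"

definition mat_image :: "complex mat \<Rightarrow> complex vec set" where
  "mat_image A = (\<lambda>v. A *\<^sub>v v) ` carrier_vec (dim_col A)"

text \<open>A simple graph is given by its vertex set and its set of edges, which are two-element sets
  of vertices. The vertex $A_i$ is represented by its index.\<close>

definition friendship_graph ::
    "nat \<Rightarrow> nat \<Rightarrow> (nat gword set \<Rightarrow> complex mat) \<Rightarrow> nat set \<times> nat set set" where
  "friendship_graph n d \<rho> =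
     ({1..n-1},
      {{i, j} | i j. i \<in> {1..n-1} \<and> j \<in> {1..n-1} \<and> i \<noteq> j \<and>
         mat_image (gen_shift n d \<rho> i) \<inter> mat_image (gen_shift n d \<rho> j) \<noteq> {0\<^sub>v d}})"

definition is_chain :: "nat set \<times> nat set set \<Rightarrow> bool" where
  "is_chain \<Gamma> \<longleftrightarrow>
     (\<forall>i\<in>fst \<Gamma>. \<forall>j\<in>fst \<Gamma>. {i, j} \<in> snd \<Gamma> \<longleftrightarrow> \<bar>int i - int j\<bar> = 1)"

section \<open>The standard representation\<close>

text \<open>Matrix indices start at 0, so rows and columns \<open>i - 1\<close>, \<open>i\<close> here are the rows and
  columns $i$, $i+1$ of the usual numbering.\<close>

definition standard_mat :: "nat \<Rightarrow> 'a::comm_ring_1 \<Rightarrow> nat \<Rightarrow> 'a mat" where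
  "standard_mat n t i = mat n n (\<lambda>(r, c).
     if r = i - 1 \<and> c = i then t
     else if r = i \<and> c = i - 1 then 1
     else if r = c \<and> r \<noteq> i - 1 \<and> r \<noteq> i then 1
     else 0)"

text \<open>The specialization at \<open>t = u\<close> of the standard representation, for \<open>u \<noteq> 0\<close>.\<close>

definition standard_rep :: "nat \<Rightarrow> complex \<Rightarrow> nat gword set \<Rightarrow> complex mat" where
  "standard_rep n u = presented_lift (GL n) (standard_mat n u)"

lemma standard_mat_carrier [simp]: "standard_mat n t i \<in> carrier_mat n n"
  by (simp add: standard_mat_def)

lemma standard_mat_mult:
  assumes "i \<in> {1..n-1}" "B \<in> carrier_mat n n" "r < n" "c < n"
  shows "(standard_mat n t i * B) $$ (r, c) =
    (if r = i - 1 then t * B $$ (i, c) else if r = i then B $$ (i - 1, c) else B $$ (r, c))"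
proof -
  define p where "p = (if r = i - 1 then i else if r = i then i - 1 else r)"
  define q where "q = (if r = i - 1 then t else 1)"
  have p: "p < n" using assms by (auto simp: p_def)
  have "(standard_mat n t i * B) $$ (r, c) = (\<Sum>k\<in>{0..<n}. standard_mat n t i $$ (r, k) * B $$ (k, c))"
    using assms by (auto simp: scalar_prod_def standard_mat_def intro!: sum.cong)
  also have "\<dots> = (\<Sum>k\<in>{0..<n}. if k = p then q * B $$ (p, c) else 0)"
    using assms by (intro sum.cong) (auto simp: standard_mat_def p_def q_def)
  also have "\<dots> = q * B $$ (p, c)" using p by simp
  finally show ?thesis by (auto simp: p_def q_def)
qed

lemma standard_mat_mult_closed: "B \<in> carrier_mat n n \<Longrightarrow> standard_mat n t i * B \<in> carrier_mat n n"
  by (rule mult_carrier_mat[OF standard_mat_carrier])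

lemma standard_mat_GL:
  assumes "u \<noteq> 0" "i \<in> {1..n-1}"
  shows "standard_mat n u i \<in> carrier (GL n)"
proof -
  define B where "B = mat n n (\<lambda>(r, c).
     if r = i - 1 \<and> c = i then 1
     else if r = i \<and> c = i - 1 then 1 / u
     else if r = c \<and> r \<noteq> i - 1 \<and> r \<noteq> i then 1
     else 0)"
  have B: "B \<in> carrier_mat n n" by (simp add: B_def)
  have 1: "standard_mat n u i * B = 1\<^sub>m n"
  proof (rule eq_matI)
    fix r c assume "r < dim_row (1\<^sub>m n :: complex mat)" "c < dim_col (1\<^sub>m n :: complex mat)"
    then have rc: "r < n" "c < n" by auto
    show "(standard_mat n u i * B) $$ (r, c) = 1\<^sub>m n $$ (r, c)"
      unfolding standard_mat_mult[OF assms(2) B rc] using assms rc by (auto simp: B_def)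
  qed (use B in \<open>auto simp: standard_mat_def\<close>)
  have "B * standard_mat n u i = 1\<^sub>m n"
    using mat_mult_left_right_inverse[OF standard_mat_carrier B 1] .
  with 1 B show ?thesis by (intro GL_carrierI[of _ _ B]) auto
qed

lemma standard_mat_entry:
  assumes "r < n" "c < n"
  shows "standard_mat n t (Suc k) $$ (r, c) =
    (if r = k \<and> c = Suc k then t else if r = Suc k \<and> c = k then 1
     else if r = c \<and> r \<noteq> k \<and> r \<noteq> Suc k then 1 else 0)"
  using assms by (simp add: standard_mat_def)

lemma standard_mat_braid:
  assumes "i \<in> {1..n-2}"
  shows "standard_mat n t i * (standard_mat n t (Suc i) * standard_mat n t i) =
         standard_mat n t (Suc i) * (standard_mat n t i * standard_mat n t (Suc i))"
proof (rule eq_matI)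
  have i: "i \<in> {1..n-1}" "Suc i \<in> {1..n-1}" using assms by auto
  obtain a where a: "i = Suc a" using assms by (cases i) auto
  have lt: "a < n" "Suc a < n" "Suc (Suc a) < n" using assms a by auto
  note mult = standard_mat_mult[OF i(1)[unfolded a]] standard_mat_mult[OF i(2)[unfolded a]]
  fix r c
  assume "r < dim_row (standard_mat n t (Suc i) * (standard_mat n t i * standard_mat n t (Suc i)))"
    "c < dim_col (standard_mat n t (Suc i) * (standard_mat n t i * standard_mat n t (Suc i)))"
  then have rc: "r < n" "c < n" by (auto simp: standard_mat_def)
  consider "r = a" | "r = Suc a" | "r = Suc (Suc a)"
    | "r \<noteq> a" "r \<noteq> Suc a" "r \<noteq> Suc (Suc a)" by blast
  then show "(standard_mat n t i * (standard_mat n t (Suc i) * standard_mat n t i)) $$ (r, c) =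
    (standard_mat n t (Suc i) * (standard_mat n t i * standard_mat n t (Suc i))) $$ (r, c)"
    unfolding a
    by cases (simp_all add: mult standard_mat_mult_closed standard_mat_entry rc lt)
qed (simp_all add: standard_mat_def)

lemma standard_mat_commute:
  assumes "i \<in> {1..n-1}" "j \<in> {1..n-1}" "\<bar>int i - int j\<bar> \<ge> 2"
  shows "standard_mat n t i * standard_mat n t j = standard_mat n t j * standard_mat n t i"
proof (rule eq_matI)
  obtain a b where ab: "i = Suc a" "j = Suc b" and lt: "Suc a < n" "Suc b < n"
    using assms(1,2) by (cases i; cases j) auto
  have far: "a \<noteq> b" "a \<noteq> Suc b" "b \<noteq> Suc a" "Suc a \<noteq> b" "Suc b \<noteq> a" "b \<noteq> a"
    using assms(3) ab by auto
  fix r c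
  assume "r < dim_row (standard_mat n t j * standard_mat n t i)"
    "c < dim_col (standard_mat n t j * standard_mat n t i)"
  then have rc: "r < n" "c < n" by (auto simp: standard_mat_def)
  have lt': "a < n" "b < n" using lt by auto
  note mult = standard_mat_mult[OF assms(1) standard_mat_carrier rc]
    standard_mat_mult[OF assms(2) standard_mat_carrier rc]
  consider "r = a" | "r = Suc a" | "r = b" | "r = Suc b"
    | "r \<noteq> a" "r \<noteq> Suc a" "r \<noteq> b" "r \<noteq> Suc b" by blast
  then show "(standard_mat n t i * standard_mat n t j) $$ (r, c) =
    (standard_mat n t j * standard_mat n t i) $$ (r, c)"
    unfolding mult unfolding ab diff_Suc_1
    by cases (simp_all add: standard_mat_entry rc lt lt' far)
qed (simp_all add: standard_mat_def)

lemma standard_mat_relations: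
  assumes "u \<noteq> 0" "(v, w) \<in> braid_relations n"
  shows "word_eval (GL n) (standard_mat n u) v = word_eval (GL n) (standard_mat n u) w"
proof -
  have one: "standard_mat n u i * 1\<^sub>m n = standard_mat n u i" for i
    by (rule right_mult_one_mat[OF standard_mat_carrier])
  from assms(2) consider
      i where "i \<in> {1..n-2}" "v = [(i, True), (Suc i, True), (i, True)]"
        "w = [(Suc i, True), (i, True), (Suc i, True)]"
    | i j where "i \<in> {1..n-1}" "j \<in> {1..n-1}" "\<bar>int i - int j\<bar> \<ge> 2"
        "v = [(i, True), (j, True)]" "w = [(j, True), (i, True)]"
    unfolding braid_relations_def by blast
  then show ?thesis
  proof cases
    case 1
    then show ?thesis by (simp only: word_eval.simps if_True GL_simps one standard_mat_braid)
  next
    case 2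
    then show ?thesis
      using standard_mat_commute[of i n j u] by (simp only: word_eval.simps if_True GL_simps one)
  qed
qed

lemma standard_rep_representation:
  assumes "u \<noteq> 0"
  shows "representation (braid_group n) n (standard_rep n u)"
  unfolding representation_def braid_group_def standard_rep_def
  by (rule presented_lift_hom[OF group_GL])
     (fact standard_mat_GL[OF assms] standard_mat_relations[OF assms])+

lemma standard_rep_gen:
  assumes "u \<noteq> 0" "i \<in> {1..n-1}"
  shows "standard_rep n u (braid_gen n i) = standard_mat n u i"
  unfolding standard_rep_def braid_gen_def
  by (rule presented_lift_gen[OF group_GL])
     (fact standard_mat_GL[OF assms(1)] standard_mat_relations[OF assms(1)] assms(2))+

end

theory Submission
  imports Defs
begin

text \<open>
  Write $\rho(\sigma_i) = 1 + A_i$ and $U_i = \mathrm{Im}(A_i)$. Two facts drive the proof.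

  If $|i-j|\ge 2$, then $A_iA_j = A_jA_i$ maps into $U_i\cap U_j = 0$, so $A_i$ kills
  $U_j$ (\<open>a_kills_U\<close>). And $\delta = \sigma_1\cdots\sigma_{n-1}$ conjugates
  $\sigma_i$ to $\sigma_{i+1}$ (\<open>prefix_prod_shift\<close>), so $\rho(\delta)$ carries $U_i$ to
  $U_{i+1}$ and $A_i$ to $A_{i+1}$.

  Choose $e_2\ne 0$ in $U_1\cap U_2$ and let $e_j = \rho(\delta)^{j-2}e_2$ for
  $1\le j\le n$. Then $e_j\in U_{j-1}\cap U_j$, as far as these are defined. Here
  $e_2\in U_1$ and $e_3\in U_3$ are independent because $U_1\cap U_3=0$; since
  $\mathrm{rank}(A_1)=2$, translation by $\delta$ gives $U_i = \langle e_i,e_{i+1}\rangle$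
  for all $i$ (\<open>U_spanned\<close>). The span of all the $e_j$ contains every $U_i$. It is therefore
  invariant, and by irreducibility it is everything, so the $e_j$ form a basis
  (\<open>image_P\<close>).

  In this basis $A_i$ kills all vectors except $e_i$ and $e_{i+1}$ (\<open>a_kills_E\<close>). Hence only
  $\sigma_1$ contributes to $\delta e_1 = e_2$, which gives $\sigma_1e_1=e_2$ and, by translation,
  $\sigma_ie_i=e_{i+1}$. Moreover $\sigma_ie_{i+1} = re_i+ce_{i+1}$ with $r$ and $c$
  independent of $i$. The braid relation forces $c = rc + c^2$ (\<open>c_eq\<close>). If $c\ne0$, then
  $r+c=1$ and $A_1$ has rank one, as in the Burau representation; this is excluded
  (\<open>c_zero\<close>). So $c=0$, and the matrices are those of $\tau_n(r)$, where $r\ne0$ because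
  $\sigma_1$ acts invertibly.
\<close>

section \<open>Subspaces and images of complex matrices\<close>

lemma complex_subspaceI:
  assumes "W \<subseteq> carrier_vec n" "0\<^sub>v n \<in> W"
    and "\<And>v w. v \<in> W \<Longrightarrow> w \<in> W \<Longrightarrow> v + w \<in> W"
    and "\<And>c v. v \<in> W \<Longrightarrow> c \<cdot>\<^sub>v v \<in> W"
  shows "VectorSpace.subspace class_ring W (module_vec TYPE(complex) n)"
  unfolding subspace_def submodule_def
  using assms vec_vs vec_module by (auto simp: module_vec_simps)

lemma complex_subspaceD:
  assumes "VectorSpace.subspace class_ring W (module_vec TYPE(complex) n)"
  shows "W \<subseteq> carrier_vec n" "0\<^sub>v n \<in> W"
    and "\<And>v w. v \<in> W \<Longrightarrow> w \<in> W \<Longrightarrow> v + w \<in> W"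
    and "\<And>c v. v \<in> W \<Longrightarrow> c \<cdot>\<^sub>v v \<in> W"
  using assms unfolding subspace_def submodule_def
  by (auto simp: module_vec_simps class_ring_simps)

lemma mat_image_eq_span_cols:
  assumes "A \<in> carrier_mat n m"
  shows "mat_image A =
    LinearCombinations.module.span class_ring (module_vec TYPE(complex) n) (set (cols A))"
proof -
  interpret vec_space "TYPE(complex)" n .
  show ?thesis
    using col_space_eq[OF assms] assms by (auto simp: mat_image_def col_space_def)
qed

lemma subspace_mat_image:
  assumes "A \<in> carrier_mat n m"
  shows "VectorSpace.subspace class_ring (mat_image A) (module_vec TYPE(complex) n)"
proof -
  interpret vec_space "TYPE(complex)" n .
  have "set (cols A) \<subseteq> carrier_vec n" using cols_dim[of A] assms by auto
  then show ?thesis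
    unfolding mat_image_eq_span_cols[OF assms] by (intro span_is_subspace) simp
qed

lemma mat_image_subset_subspace:
  assumes A: "A \<in> carrier_mat n m"
    and W: "VectorSpace.subspace class_ring W (module_vec TYPE(complex) n)"
    and "\<And>j. j < m \<Longrightarrow> col A j \<in> W"
  shows "mat_image A \<subseteq> W"
proof -
  interpret vec_space "TYPE(complex)" n .
  have "set (cols A) \<subseteq> W"
    using assms by (auto simp: cols_def)
  then show ?thesis
    unfolding mat_image_eq_span_cols[OF A] using W by (intro span_is_subset) auto
qed

text \<open>The image of \<open>A\<close> is the span of its columns, so its dimension is the rank, and
  two independent vectors in a plane form a basis of it.\<close>

lemma rank_two_image_spanned:
  assumes A: "A \<in> carrier_mat n m" and rank: "vec_space.rank n A = 2"
    and x: "x \<in> mat_image A" and y: "y \<in> mat_image A"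
    and indep: "\<And>\<alpha> \<beta>. \<alpha> \<cdot>\<^sub>v x + \<beta> \<cdot>\<^sub>v y = 0\<^sub>v n \<Longrightarrow> \<alpha> = 0 \<and> \<beta> = 0"
    and v: "v \<in> mat_image A"
  shows "\<exists>\<alpha> \<beta>. v = \<alpha> \<cdot>\<^sub>v x + \<beta> \<cdot>\<^sub>v y"
proof -
  interpret vec_space "TYPE(complex)" n .
  let ?S = "span (set (cols A))"
  have colsA: "set (cols A) \<subseteq> carrier_vec n" using cols_dim[of A] A by auto
  have im: "mat_image A = ?S" by (rule mat_image_eq_span_cols[OF A])
  have sub: "subspace class_ring ?S V" using span_is_subspace[OF colsA] .
  then have subm: "submodule class_ring ?S V" by simp
  have inV: "?S \<subseteq> carrier_vec n" using complex_subspaceD(1)[OF sub] .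
  have xy: "x \<in> ?S" "y \<in> ?S" "x \<in> carrier_vec n" "y \<in> carrier_vec n" 
    using x y im inV by auto
  have ne: "x \<noteq> y"
  proof
    assume "x = y"
    then have "1 \<cdot>\<^sub>v x + (- 1) \<cdot>\<^sub>v y = 0\<^sub>v n" using xy by auto
    from indep[OF this] show False by simp
  qed
  have lc: "lincomb f {x, y} = f x \<cdot>\<^sub>v x + f y \<cdot>\<^sub>v y" for f
  proof -
    have "lincomb f {x, y} = f x \<cdot>\<^sub>v x + lincomb f {y}"
      using lincomb_insert2[of "{y}" f x] xy ne by (auto simp: module_vec_simps class_ring_simps)
    also have "lincomb f {y} = f y \<cdot>\<^sub>v y"
      using lincomb_insert2[of "{}" f y] xy by (auto simp: module_vec_simps class_ring_simps lincomb_def)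
    finally show ?thesis .
  qed
  have li: "lin_indpt {x, y}"
  proof (rule finite_lin_indpt2)
    fix f assume True "lincomb f {x, y} = 0\<^sub>v n"
    then have "f x = 0 \<and> f y = 0" using indep lc by simp
    then show "\<forall>v\<in>{x, y}. f v = 0" by simp
  qed (use xy in auto)
  interpret W: vectorspace class_ring "vs ?S" using subspace_is_vs[OF sub] .
  have "W.lin_indpt {x, y}"
    using span_li_not_depend(2)[OF _ subm, of "{x, y}"] xy li by auto
  moreover have "W.dim = 2" using rank by (simp add: rank_def)
  moreover have "W.fin_dim" by (rule fin_dim_span_cols[OF A])
  ultimately have "W.basis {x, y}"
    using xy ne by (intro W.dim_li_is_basis) auto
  then have "W.span {x, y} = ?S" by (simp add: W.basis_def)
  then have "v \<in> span {x, y}"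
    using span_li_not_depend(1)[OF _ subm, of "{x, y}"] xy v im by auto
  then obtain f where "v = lincomb f {x, y}"
    using finite_span[of "{x, y}"] xy by auto
  then show ?thesis using lc by blast
qed

section \<open>Homomorphisms out of a presented group\<close>

lemma presented_word_Cons:
  assumes "s \<in> S" "w \<in> gwords S"
  shows "pres_cong S R `` {(s, b) # w} =
    pres_cong S R `` {[(s, b)]} \<otimes>\<^bsub>presented_group S R\<^esub> pres_cong S R `` {w}"
  using assms by (simp add: presented_mult)

lemma presented_gen_inv:
  assumes "s \<in> S"
  shows "pres_cong S R `` {[(s, False)]} = inv\<^bsub>presented_group S R\<^esub> presented_gen S R s"
proof -
  interpret group "presented_group S R" by (rule group_presented)
  have "pres_cong S R `` {[(s, False)]} \<otimes>\<^bsub>presented_group S R\<^esub> presented_gen S R s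
    = \<one>\<^bsub>presented_group S R\<^esub>"
    using equiv_class_eq[OF equiv_pres_cong pres_cong.cancel[OF assms, of False R]] assms
    by (simp add: presented_gen_def presented_mult presented_one)
  then show ?thesis
    using assms by (intro inv_equality[symmetric]) (auto simp: presented_gen_def)
qed

lemma presented_gen_closed:
  "s \<in> S \<Longrightarrow> presented_gen S R s \<in> carrier (presented_group S R)"
  by (auto simp: presented_gen_def)

text \<open>Every element is the class of a word, so a property that survives multiplication on the
  left by the generators and by their inverses holds everywhere. In this form no words occur.\<close>

lemma presented_group_induct [consumes 1, case_names one gen inv]:
  assumes "X \<in> carrier (presented_group S R)"
    and "P \<one>\<^bsub>presented_group S R\<^esub>"
    and gen: "\<And>s X. s \<in> S \<Longrightarrow> X \<in> carrier (presented_group S R) \<Longrightarrow> P X \<Longrightarrow>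
      P (presented_gen S R s \<otimes>\<^bsub>presented_group S R\<^esub> X)"
    and inv: "\<And>s X. s \<in> S \<Longrightarrow> X \<in> carrier (presented_group S R) \<Longrightarrow> P X \<Longrightarrow>
      P (inv\<^bsub>presented_group S R\<^esub> presented_gen S R s \<otimes>\<^bsub>presented_group S R\<^esub> X)"
  shows "P X"
proof -
  obtain w where w: "w \<in> gwords S" "X = pres_cong S R `` {w}"
    using assms(1) by (rule presented_carrierE)
  have "P (pres_cong S R `` {w})" using w(1)
  proof (induction w)
    case Nil
    then show ?case using assms(2) by (simp add: presented_one)
  next
    case (Cons x w)
    obtain s b where x: "x = (s, b)" by (cases x)
    have s: "s \<in> S" and w: "w \<in> gwords S" using Cons.prems x by auto
    note IH = Cons.IH[OF w]
    show ?case
      unfolding x presented_word_Cons[OF s w]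
      using gen[OF s presented_carrierI[OF w] IH] inv[OF s presented_carrierI[OF w] IH]
      by (cases b) (simp_all add: presented_gen_inv[OF s] flip: presented_gen_def)
  qed
  then show ?thesis using w(2) by simp
qed

lemma presented_hom_eqI:
  assumes "group G" "\<phi> \<in> hom (presented_group S R) G" "\<psi> \<in> hom (presented_group S R) G"
    and eq: "\<And>s. s \<in> S \<Longrightarrow> \<phi> (presented_gen S R s) = \<psi> (presented_gen S R s)"
    and X: "X \<in> carrier (presented_group S R)"
  shows "\<phi> X = \<psi> X"
proof -
  interpret F: group "presented_group S R" by (rule group_presented)
  interpret G: group G by fact
  interpret \<phi>: group_hom "presented_group S R" G \<phi> by unfold_locales fact
  interpret \<psi>: group_hom "presented_group S R" G \<psi> by unfold_locales fact
  show ?thesis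
    using X by (induction rule: presented_group_induct) (simp_all add: eq presented_gen_closed)
qed

text \<open>Conjugating \<open>\<psi>\<close> by \<open>p\<close> gives again a homomorphism, so an intertwining relation
  needs to be checked on the generators only.\<close>

lemma presented_conjugate_homs:
  assumes "group G" "\<phi> \<in> hom (presented_group S R) G" "\<psi> \<in> hom (presented_group S R) G"
    and p: "p \<in> carrier G"
    and eq: "\<And>s. s \<in> S \<Longrightarrow> \<phi> (presented_gen S R s) \<otimes>\<^bsub>G\<^esub> p = p \<otimes>\<^bsub>G\<^esub> \<psi> (presented_gen S R s)"
    and X: "X \<in> carrier (presented_group S R)"
  shows "\<phi> X = p \<otimes>\<^bsub>G\<^esub> \<psi> X \<otimes>\<^bsub>G\<^esub> inv\<^bsub>G\<^esub> p"
proof (rule presented_hom_eqI[OF assms(1,2) _ _ X])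
  interpret G: group G by fact
  have cl: "\<phi> Y \<in> carrier G" "\<psi> Y \<in> carrier G" if "Y \<in> carrier (presented_group S R)" for Y
    using assms(2,3) that by (auto simp: hom_def)
  show "(\<lambda>X. p \<otimes>\<^bsub>G\<^esub> \<psi> X \<otimes>\<^bsub>G\<^esub> inv\<^bsub>G\<^esub> p) \<in> hom (presented_group S R) G"
  proof (rule homI)
    fix Y Z assume YZ: "Y \<in> carrier (presented_group S R)" "Z \<in> carrier (presented_group S R)"
    have "inv\<^bsub>G\<^esub> p \<otimes>\<^bsub>G\<^esub> (p \<otimes>\<^bsub>G\<^esub> x) = x" if "x \<in> carrier G" for x
      using p that by (simp flip: G.m_assoc)
    then show "p \<otimes>\<^bsub>G\<^esub> \<psi> (Y \<otimes>\<^bsub>presented_group S R\<^esub> Z) \<otimes>\<^bsub>G\<^esub> inv\<^bsub>G\<^esub> p =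
        p \<otimes>\<^bsub>G\<^esub> \<psi> Y \<otimes>\<^bsub>G\<^esub> inv\<^bsub>G\<^esub> p \<otimes>\<^bsub>G\<^esub> (p \<otimes>\<^bsub>G\<^esub> \<psi> Z \<otimes>\<^bsub>G\<^esub> inv\<^bsub>G\<^esub> p)"
      using p cl YZ hom_mult[OF assms(3)] by (simp add: G.m_assoc)
  qed (use p cl in auto)
  fix s assume "s \<in> S"
  then have gen: "presented_gen S R s \<in> carrier (presented_group S R)" by (rule presented_gen_closed)
  have "\<phi> (presented_gen S R s) = \<phi> (presented_gen S R s) \<otimes>\<^bsub>G\<^esub> p \<otimes>\<^bsub>G\<^esub> inv\<^bsub>G\<^esub> p"
    using p cl gen by (simp add: G.m_assoc)
  then show "\<phi> (presented_gen S R s) = p \<otimes>\<^bsub>G\<^esub> \<psi> (presented_gen S R s) \<otimes>\<^bsub>G\<^esub> inv\<^bsub>G\<^esub> p"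
    using eq[OF \<open>s \<in> S\<close>] by simp
qed

section \<open>Conjugating each braid generator to the next\<close>

lemma braid_gen_closed: "i \<in> {1..n-1} \<Longrightarrow> braid_gen n i \<in> carrier (braid_group n)"
  unfolding braid_gen_def braid_group_def by (rule presented_gen_closed)

lemma braid_gen_braid:
  assumes "i \<in> {1..n-2}"
  shows "braid_gen n i \<otimes>\<^bsub>braid_group n\<^esub> (braid_gen n (Suc i) \<otimes>\<^bsub>braid_group n\<^esub> braid_gen n i) =
    braid_gen n (Suc i) \<otimes>\<^bsub>braid_group n\<^esub> (braid_gen n i \<otimes>\<^bsub>braid_group n\<^esub> braid_gen n (Suc i))"
proof -
  have i: "i \<in> {1..n-1}" "Suc i \<in> {1..n-1}" using assms by auto
  have "([(i, True), (Suc i, True), (i, True)], [(Suc i, True), (i, True), (Suc i, True)])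
    \<in> pres_cong {1..n-1} (braid_relations n)"
    using assms i by (intro pres_cong.relation) (auto simp: braid_relations_def)
  from equiv_class_eq[OF equiv_pres_cong this] show ?thesis
    using i by (simp add: braid_gen_def braid_group_def presented_gen_def presented_mult)
qed

lemma braid_gen_commute:
  assumes "i \<in> {1..n-1}" "j \<in> {1..n-1}" "\<bar>int i - int j\<bar> \<ge> 2"
  shows "braid_gen n i \<otimes>\<^bsub>braid_group n\<^esub> braid_gen n j =
    braid_gen n j \<otimes>\<^bsub>braid_group n\<^esub> braid_gen n i"
proof -
  have "([(i, True), (j, True)], [(j, True), (i, True)])
    \<in> pres_cong {1..n-1} (braid_relations n)"
    using assms by (intro pres_cong.relation) (auto simp: braid_relations_def)
  from equiv_class_eq[OF equiv_pres_cong this] show ?thesis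
    using assms by (simp add: braid_gen_def braid_group_def presented_gen_def presented_mult)
qed

primrec (in monoid) prefix_prod :: "(nat \<Rightarrow> 'a) \<Rightarrow> nat \<Rightarrow> 'a" where
  "prefix_prod s 0 = \<one>"
| "prefix_prod s (Suc k) = prefix_prod s k \<otimes> s k"

lemma (in monoid) prefix_prod_closed:
  "(\<And>i. i < k \<Longrightarrow> s i \<in> carrier G) \<Longrightarrow> prefix_prod s k \<in> carrier G"
  by (induction k) auto

lemma (in monoid) prefix_prod_commute:
  assumes "\<And>i. i < k \<Longrightarrow> s i \<in> carrier G" "x \<in> carrier G"
    and "\<And>i. i < k \<Longrightarrow> s i \<otimes> x = x \<otimes> s i"
  shows "prefix_prod s k \<otimes> x = x \<otimes> prefix_prod s k"
  using assms
proof (induction k)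
  case (Suc k)
  have p: "prefix_prod s k \<in> carrier G" using Suc.prems by (intro prefix_prod_closed) auto
  have "prefix_prod s k \<otimes> s k \<otimes> x = prefix_prod s k \<otimes> x \<otimes> s k"
    using p Suc.prems by (simp add: m_assoc)
  also have "\<dots> = x \<otimes> (prefix_prod s k \<otimes> s k)"
    using Suc p by (simp add: m_assoc)
  finally show ?case by simp
qed auto

text \<open>For the braid generators the full product
  $\delta = \sigma_1\cdots\sigma_{n-1}$ conjugates $\sigma_i$ to $\sigma_{i+1}$: pushed into
  $\delta$ from the left, $\sigma_{i+1}$ commutes with the factors before $\sigma_i$, becomes
  $\sigma_i$ by $\sigma_{i+1}\sigma_i\sigma_{i+1} = \sigma_i\sigma_{i+1}\sigma_i$, and
  commutes with all later factors.\<close>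

lemma (in monoid) prefix_prod_shift:
  assumes closed: "\<And>i. i < m \<Longrightarrow> s i \<in> carrier G"
    and braid: "\<And>i. Suc i < m \<Longrightarrow> s i \<otimes> (s (Suc i) \<otimes> s i) = s (Suc i) \<otimes> (s i \<otimes> s (Suc i))"
    and comm: "\<And>i j. i < m \<Longrightarrow> j < m \<Longrightarrow> Suc i < j \<Longrightarrow> s i \<otimes> s j = s j \<otimes> s i"
    and "Suc i < k" "k \<le> m"
  shows "prefix_prod s k \<otimes> s i = s (Suc i) \<otimes> prefix_prod s k"
  using assms(4,5)
proof (induction k)
  case (Suc k)
  have p: "prefix_prod s k \<in> carrier G" using Suc.prems closed by (intro prefix_prod_closed) auto
  have cl: "s k \<in> carrier G" "s i \<in> carrier G" "s (Suc i) \<in> carrier G"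
    using closed Suc.prems by auto
  show ?case
  proof (cases "k = Suc i")
    case True
    have q: "prefix_prod s i \<in> carrier G" using Suc.prems closed by (intro prefix_prod_closed) auto
    have "prefix_prod s i \<otimes> s (Suc i) = s (Suc i) \<otimes> prefix_prod s i"
      using Suc.prems by (intro prefix_prod_commute closed comm) auto
    then have "s (Suc i) \<otimes> (prefix_prod s i \<otimes> (s i \<otimes> s (Suc i))) =
        prefix_prod s i \<otimes> (s (Suc i) \<otimes> (s i \<otimes> s (Suc i)))"
      using q cl by (simp flip: m_assoc)
    also have "\<dots> = prefix_prod s i \<otimes> (s i \<otimes> (s (Suc i) \<otimes> s i))"
      using braid[of i] Suc.prems by simp
    finally show ?thesis using q cl True by (simp add: m_assoc)
  next
    case False
    then have "s i \<otimes> s k = s k \<otimes> s i" using comm[of i k] Suc.prems by simp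
    then have "prefix_prod s k \<otimes> s k \<otimes> s i = prefix_prod s k \<otimes> s i \<otimes> s k"
      using p cl by (simp add: m_assoc)
    then show ?thesis using Suc False p cl by (simp add: m_assoc)
  qed
qed simp

section \<open>A basis adapted to the chain\<close>

text \<open>The matrix \<open>s k\<close> is the image of $\sigma_{k+1}$; counting from 0 makes the basis vector
  \<open>E k\<close> below the column \<open>k\<close> of the change of basis. The vector \<open>f\<close> witnesses the edge
  between the first two vertices; the remaining edges follow from it by conjugation.
  Irreducibility is stated for subspaces containing all the images \<open>mat_image (s k - 1)\<close>:
  these are invariant under the whole group, inverses included, so the group itself need not
  be mentioned.\<close>

locale chain_generators =
  fixes n :: nat and s :: "nat \<Rightarrow> complex mat" and f :: "complex vec"
  assumes n4: "4 \<le> n"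
    and s_GL: "Suc k < n \<Longrightarrow> s k \<in> carrier (GL n)"
    and braid: "Suc (Suc k) < n \<Longrightarrow> s k * (s (Suc k) * s k) = s (Suc k) * (s k * s (Suc k))"
    and comm: "Suc i < j \<Longrightarrow> Suc j < n \<Longrightarrow> s i * s j = s j * s i"
    and rank: "vec_space.rank n (s 0 - 1\<^sub>m n) = 2"
    and f_mem: "f \<in> mat_image (s 0 - 1\<^sub>m n)" "f \<in> mat_image (s 1 - 1\<^sub>m n)"
    and f_nonzero: "f \<noteq> 0\<^sub>v n"
    and no_edge: "Suc i < j \<Longrightarrow> Suc j < n \<Longrightarrow>
      mat_image (s i - 1\<^sub>m n) \<inter> mat_image (s j - 1\<^sub>m n) = {0\<^sub>v n}"
    and irreducible: "VectorSpace.subspace class_ring W (module_vec TYPE(complex) n) \<Longrightarrow>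
      (\<And>k. Suc k < n \<Longrightarrow> mat_image (s k - 1\<^sub>m n) \<subseteq> W) \<Longrightarrow> W = {0\<^sub>v n} \<or> W = carrier_vec n"
begin

definition a :: "nat \<Rightarrow> complex mat" where "a k = s k - 1\<^sub>m n"

abbreviation U :: "nat \<Rightarrow> complex vec set" where "U k \<equiv> mat_image (a k)"

definition D :: "complex mat" where "D = monoid.prefix_prod (GL n) s (n - 1)"

definition D' :: "complex mat" where "D' = inv\<^bsub>GL n\<^esub> D"

text \<open>In the standard representation $\delta$ sends each basis vector except the last one to
  the next. This dictates the basis: start from the vector \<open>f\<close> shared by the first two images,
  which has to be the second basis vector up to a scalar, and move it by powers of $\delta$. Intersections of
  neighbouring images determine the inner basis vectors up to scalars but say nothing about the
  two outer ones; $\delta$ determines these, and all the scalars up to a common one.\<close>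

primrec E :: "nat \<Rightarrow> complex vec" where
  "E 0 = D' *\<^sub>v f"
| "E (Suc j) = D *\<^sub>v E j"

declare E.simps [simp del]

lemma D_E [simp]: "D *\<^sub>v E j = E (Suc j)"
  by (simp add: E.simps)

lemma s_mat: "Suc k < n \<Longrightarrow> s k \<in> carrier_mat n n"
  by (intro GL_carrier_mat s_GL)

lemma a_mat: "Suc k < n \<Longrightarrow> a k \<in> carrier_mat n n"
  unfolding a_def by (intro minus_carrier_mat) simp

lemma D_GL: "D \<in> carrier (GL n)"
proof -
  interpret G: group "GL n" by (rule group_GL)
  show ?thesis unfolding D_def by (intro G.prefix_prod_closed s_GL) auto
qed

lemma D_mat: "D \<in> carrier_mat n n" "D' \<in> carrier_mat n n"
  and D_inv: "D * D' = 1\<^sub>m n" "D' * D = 1\<^sub>m n"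
proof -
  interpret G: group "GL n" by (rule group_GL)
  show "D \<in> carrier_mat n n" "D' \<in> carrier_mat n n"
    using D_GL unfolding D'_def by (auto intro!: GL_carrier_mat G.inv_closed)
  show "D * D' = 1\<^sub>m n" "D' * D = 1\<^sub>m n"
    using G.r_inv[OF D_GL] G.l_inv[OF D_GL] by (simp_all only: D'_def GL_simps(2,3))
qed

lemma D_inv_vec:
  assumes "v \<in> carrier_vec n"
  shows "D *\<^sub>v (D' *\<^sub>v v) = v" "D' *\<^sub>v (D *\<^sub>v v) = v"
  using assms D_mat D_inv by (simp_all flip: assoc_mult_mat_vec)

lemma D_shift:
  assumes "Suc (Suc k) < n"
  shows "D * s k = s (Suc k) * D"
proof -
  interpret G: group "GL n" by (rule group_GL)
  have "G.prefix_prod s (n - 1) \<otimes>\<^bsub>GL n\<^esub> s k = s (Suc k) \<otimes>\<^bsub>GL n\<^esub> G.prefix_prod s (n - 1)"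
  proof (rule G.prefix_prod_shift[of "n - 1"])
    show "s i \<in> carrier (GL n)" if "i < n - 1" for i using that by (intro s_GL) simp
    show "s i \<otimes>\<^bsub>GL n\<^esub> (s (Suc i) \<otimes>\<^bsub>GL n\<^esub> s i) =
        s (Suc i) \<otimes>\<^bsub>GL n\<^esub> (s i \<otimes>\<^bsub>GL n\<^esub> s (Suc i))" if "Suc i < n - 1" for i
      using braid[of i] that by (simp add: GL_simps(2))
    show "s i \<otimes>\<^bsub>GL n\<^esub> s j = s j \<otimes>\<^bsub>GL n\<^esub> s i"
      if "i < n - 1" "j < n - 1" "Suc i < j" for i j
      using comm[of i j] that by (simp add: GL_simps(2))
  qed (use assms in auto)
  then show ?thesis by (simp add: D_def GL_simps(2))
qed

lemma s_vec: "Suc k < n \<Longrightarrow> v \<in> carrier_vec n \<Longrightarrow> s k *\<^sub>v v \<in> carrier_vec n"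
  using s_mat by (rule mult_mat_vec_carrier)

lemma a_vec: "Suc k < n \<Longrightarrow> v \<in> carrier_vec n \<Longrightarrow> a k *\<^sub>v v \<in> carrier_vec n"
  using a_mat by (rule mult_mat_vec_carrier)

lemma D_vec: "v \<in> carrier_vec n \<Longrightarrow> D *\<^sub>v v \<in> carrier_vec n"
  using D_mat(1) by (rule mult_mat_vec_carrier)

lemma a_apply:
  assumes "Suc k < n" "v \<in> carrier_vec n"
  shows "a k *\<^sub>v v = s k *\<^sub>v v - v"
  using minus_mult_distrib_mat_vec[OF s_mat[OF assms(1)] one_carrier_mat assms(2)] assms(2)
  by (simp add: a_def)

lemma s_apply:
  assumes "Suc k < n" "v \<in> carrier_vec n"
  shows "s k *\<^sub>v v = v + a k *\<^sub>v v"
  using assms s_vec[OF assms] carrier_matD[OF s_mat[OF assms(1)]]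
  by (auto simp: a_apply intro!: eq_vecI)

lemma D_s_vec:
  assumes "Suc (Suc k) < n" "v \<in> carrier_vec n"
  shows "D *\<^sub>v (s k *\<^sub>v v) = s (Suc k) *\<^sub>v (D *\<^sub>v v)"
  using assms D_mat s_mat[of k] s_mat[of "Suc k"] D_shift[of k]
  by (simp flip: assoc_mult_mat_vec)

lemma D_a_vec:
  assumes "Suc (Suc k) < n" "v \<in> carrier_vec n"
  shows "D *\<^sub>v (a k *\<^sub>v v) = a (Suc k) *\<^sub>v (D *\<^sub>v v)"
  using assms D_vec s_vec D_s_vec[OF assms] D_mat(1)
  by (simp add: a_apply mult_minus_distrib_mat_vec)

lemma U_iff:
  assumes "Suc k < n"
  shows "v \<in> U k \<longleftrightarrow> (\<exists>w\<in>carrier_vec n. v = a k *\<^sub>v w)"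
  using a_mat[OF assms] by (auto simp: mat_image_def)

lemma U_carrier: "Suc k < n \<Longrightarrow> v \<in> U k \<Longrightarrow> v \<in> carrier_vec n"
  using a_vec by (auto simp: U_iff)

lemma U_shift:
  assumes "Suc (Suc k) < n" "v \<in> carrier_vec n"
  shows "D *\<^sub>v v \<in> U (Suc k) \<longleftrightarrow> v \<in> U k"
proof
  assume "v \<in> U k"
  then obtain w where "w \<in> carrier_vec n" "v = a k *\<^sub>v w" using assms by (auto simp: U_iff)
  then show "D *\<^sub>v v \<in> U (Suc k)"
    using assms D_a_vec D_vec by (auto simp: U_iff)
next
  assume "D *\<^sub>v v \<in> U (Suc k)"
  then obtain w where w: "w \<in> carrier_vec n" "D *\<^sub>v v = a (Suc k) *\<^sub>v w"
    using assms by (auto simp: U_iff)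
  define w' where "w' = D' *\<^sub>v w"
  have w': "w' \<in> carrier_vec n" "w = D *\<^sub>v w'"
    using w(1) D_mat D_inv_vec by (auto simp: w'_def)
  have "D *\<^sub>v v = D *\<^sub>v (a k *\<^sub>v w')"
    using w w' D_a_vec assms by simp
  then have "v = a k *\<^sub>v w'"
    using D_inv_vec(2) assms a_vec w' by (metis Suc_lessD)
  then show "v \<in> U k" using w' assms by (auto simp: U_iff)
qed

lemma f_carrier: "f \<in> carrier_vec n"
  using U_carrier[of 0 f] f_mem(1) n4 by (simp add: a_def)

lemma E_carrier: "E j \<in> carrier_vec n"
  using f_carrier D_mat by (induction j) (auto simp: E.simps simp del: D_E)

lemma E_1: "E 1 = f"
  using f_carrier by (simp add: E.simps D_inv_vec del: D_E)

lemma E_nonzero: "E j \<noteq> 0\<^sub>v n"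
proof -
  have D0: "D *\<^sub>v v \<noteq> 0\<^sub>v n" if "v \<in> carrier_vec n" "v \<noteq> 0\<^sub>v n" for v
  proof
    assume "D *\<^sub>v v = 0\<^sub>v n"
    then have "v = D' *\<^sub>v 0\<^sub>v n" using D_inv_vec(2)[OF that(1)] by simp
    also have "\<dots> = 0\<^sub>v n" using D_mat by auto
    finally show False using that(2) by simp
  qed
  have "E 0 \<noteq> 0\<^sub>v n"
  proof
    assume "E 0 = 0\<^sub>v n"
    then have "E 1 = D *\<^sub>v 0\<^sub>v n" using D_E[of 0] by simp
    also have "\<dots> = 0\<^sub>v n" using D_mat by auto
    finally have "E 1 = 0\<^sub>v n" .
    then show False using E_1 f_nonzero by simp
  qed
  then show ?thesis
  proof (induction j)
    case (Suc j)
    then show ?case using D0[OF E_carrier, of j] by simp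
  qed
qed

lemma E_mem_U: "Suc j < n \<Longrightarrow> E j \<in> U j"
proof (induction j)
  case 0
  then show ?case
    using U_shift[of 0 "E 0"] E_carrier E_1 f_mem(2) n4 by (simp add: a_def)
next
  case (Suc j)
  then show ?case using U_shift[of j "E j"] E_carrier by simp
qed

lemma E_Suc_mem_U: "Suc j < n \<Longrightarrow> E (Suc j) \<in> U j"
proof (induction j)
  case 0
  then show ?case using E_1 f_mem(1) by (simp add: a_def)
next
  case (Suc j)
  then show ?case using U_shift[of j "E (Suc j)"] E_carrier by simp
qed

lemma U_disjoint:
  assumes "Suc i < j \<or> Suc j < i" "Suc i < n" "Suc j < n"
  shows "U i \<inter> U j = {0\<^sub>v n}"
  using no_edge[of i j] no_edge[of j i] assms by (auto simp: a_def Int_commute)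

lemma a_commute:
  assumes "Suc i < j \<or> Suc j < i" "Suc i < n" "Suc j < n" "w \<in> carrier_vec n"
  shows "a i *\<^sub>v (a j *\<^sub>v w) = a j *\<^sub>v (a i *\<^sub>v w)"
proof -
  have "s i * s j = s j * s i" using comm[of i j] comm[of j i] assms by auto
  then have "s i *\<^sub>v (s j *\<^sub>v w) = s j *\<^sub>v (s i *\<^sub>v w)"
    using assoc_mult_mat_vec[OF s_mat[OF assms(2)] s_mat[OF assms(3)] assms(4)]
      assoc_mult_mat_vec[OF s_mat[OF assms(3)] s_mat[OF assms(2)] assms(4)] by simp
  then show ?thesis
    using assms s_vec mult_minus_distrib_mat_vec[OF s_mat, of _ _ w]
      carrier_matD(1)[OF s_mat[OF assms(2)]] carrier_matD(1)[OF s_mat[OF assms(3)]]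
    by (auto simp: a_apply intro!: eq_vecI)
qed

text \<open>For distant \<open>i\<close> and \<open>j\<close> the product \<open>a i * a j = a j * a i\<close> has its image in
  \<open>U i \<inter> U j\<close>, hence vanishes.\<close>

lemma a_kills_U:
  assumes "Suc i < j \<or> Suc j < i" "Suc i < n" "Suc j < n" "v \<in> U j"
  shows "a i *\<^sub>v v = 0\<^sub>v n"
proof -
  obtain w where w: "w \<in> carrier_vec n" "v = a j *\<^sub>v w" using assms by (auto simp: U_iff)
  have "a i *\<^sub>v v = a j *\<^sub>v (a i *\<^sub>v w)"
    using w a_commute[OF assms(1-3)] by simp
  moreover have "a i *\<^sub>v v \<in> U i" using assms(2,3) w a_vec by (auto simp: U_iff)
  moreover have "a j *\<^sub>v (a i *\<^sub>v w) \<in> U j" using assms(2,3) w a_vec by (auto simp: U_iff)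
  ultimately have "a i *\<^sub>v v \<in> U i \<inter> U j" by simp
  then show ?thesis using U_disjoint[OF assms(1-3)] by simp
qed

text \<open>Each \<open>E j\<close> lies in \<open>U (j - 1)\<close> and in \<open>U j\<close>, as far as these exist, and
  one of the two is distant from \<open>U i\<close>. The exceptions are \<open>a 1\<close> on the first vector and
  \<open>a (n - 3)\<close> on the last one, since the outer vectors lie in one image only. There one
  translates by \<open>D\<close>, forwards or backwards, to a case already settled.\<close>

lemma a_kills_E:
  assumes i: "Suc i < n" and j: "j < n" "j \<noteq> i" "j \<noteq> Suc i"
  shows "a i *\<^sub>v E j = 0\<^sub>v n"
proof -
  consider "j < i" "0 < j" | "j = 0" "1 < i" | "j = 0" "i = 1" | "Suc i < j" "Suc j < n"
    | "Suc (Suc i) < j" | "j = Suc (Suc i)" "Suc j = n"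
    using j i by linarith
  then show ?thesis
  proof cases
    case 1
    then show ?thesis using a_kills_U[of i "j - 1"] E_Suc_mem_U[of "j - 1"] i by auto
  next
    case 2
    then show ?thesis using a_kills_U[of i 0] E_mem_U[of 0] i by auto
  next
    \<comment> \<open>\<open>E 0\<close> lies in \<open>U 0\<close>, which is adjacent to \<open>U 1\<close>; its translate \<open>E 1\<close> also lies in
      \<open>U 0\<close>, and that is distant from \<open>U 2\<close>.\<close>
    case 3
    have "D *\<^sub>v (a 1 *\<^sub>v E 0) = a 2 *\<^sub>v E 1"
      using D_a_vec[of 1 "E 0"] n4 E_carrier by (simp add: numeral_2_eq_2)
    also have "\<dots> = 0\<^sub>v n" using a_kills_U[of 2 0] E_Suc_mem_U[of 0] n4 by simp
    finally have "D' *\<^sub>v (D *\<^sub>v (a 1 *\<^sub>v E 0)) = D' *\<^sub>v 0\<^sub>v n" by simp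
    then have "a 1 *\<^sub>v E 0 = 0\<^sub>v n"
      using D_inv_vec(2)[OF a_vec[OF _ E_carrier]] n4 D_mat by auto
    then show ?thesis using 3 by simp
  next
    case 4
    then show ?thesis using a_kills_U[of i j] E_mem_U[of j] i by auto
  next
    case 5
    then show ?thesis using a_kills_U[of i "j - 1"] E_Suc_mem_U[of "j - 1"] i j by auto
  next
    \<comment> \<open>Here \<open>E j\<close> is the last vector, the translate of a vector in \<open>U (Suc i)\<close>.\<close>
    case 6
    then obtain i' where i': "i = Suc i'" using n4 by (cases i) auto
    have "a i' *\<^sub>v E (Suc i) = 0\<^sub>v n"
      using a_kills_U[of i' "Suc i'"] a_kills_U[of i' "Suc i"] E_mem_U[of "Suc i"] 6 i' by auto
    then have "D *\<^sub>v (a i' *\<^sub>v E (Suc i)) = 0\<^sub>v n" using D_mat by auto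
    then show ?thesis using D_a_vec[of i' "E (Suc i)"] 6 i' i E_carrier by simp
  qed
qed

lemma s_fixes_E:
  assumes "Suc i < n" "j < n" "j \<noteq> i" "j \<noteq> Suc i"
  shows "s i *\<^sub>v E j = E j"
  using assms a_kills_E E_carrier by (simp add: s_apply)

text \<open>All factors of \<open>D\<close> except the first fix \<open>E 0\<close>. This is where the normalisation of the
  basis by \<open>D\<close> pays off: it turns the unknown first column of the action of \<open>s 0\<close> into that of
  the standard representation.\<close>

lemma D_E_0: "D *\<^sub>v E 0 = s 0 *\<^sub>v E 0"
proof -
  interpret G: group "GL n" by (rule group_GL)
  have "G.prefix_prod s (Suc k) *\<^sub>v E 0 = s 0 *\<^sub>v E 0" if "Suc k < n" for k
    using that
  proof (induction k)
    case 0
    then show ?case using s_mat[of 0] by (simp add: GL_simps(2,3))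
  next
    case (Suc k)
    have p: "G.prefix_prod s (Suc k) \<in> carrier_mat n n"
      using Suc.prems by (intro GL_carrier_mat G.prefix_prod_closed s_GL) auto
    have "G.prefix_prod s (Suc (Suc k)) *\<^sub>v E 0 = G.prefix_prod s (Suc k) *\<^sub>v (s (Suc k) *\<^sub>v E 0)"
      using p Suc.prems s_mat[of "Suc k"] E_carrier[of 0]
      by (simp add: GL_simps(2) del: G.prefix_prod.simps(1) flip: assoc_mult_mat_vec)
    then show ?case using Suc s_fixes_E[of "Suc k" 0] by simp
  qed
  from this[of "n - 2"] n4 show ?thesis by (simp add: D_def numeral_2_eq_2 Suc_diff_Suc)
qed

lemma s_E: "Suc k < n \<Longrightarrow> s k *\<^sub>v E k = E (Suc k)"
proof (induction k)
  case 0
  then show ?case using D_E_0 by simp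
next
  case (Suc k)
  then show ?case using D_s_vec[of k "E k"] E_carrier by simp
qed

text \<open>A relation between \<open>E 0\<close> and \<open>E 1\<close> gives one between \<open>E 1\<close> and \<open>E 2\<close>, and these lie
  in \<open>U 0\<close> and \<open>U 2\<close>, which meet in 0.\<close>

lemma E01_indep:
  assumes "\<alpha> \<cdot>\<^sub>v E 0 + \<beta> \<cdot>\<^sub>v E 1 = 0\<^sub>v n"
  shows "\<alpha> = 0 \<and> \<beta> = 0"
proof -
  note E = E_carrier
  have "D *\<^sub>v (\<alpha> \<cdot>\<^sub>v E 0 + \<beta> \<cdot>\<^sub>v E 1) = \<alpha> \<cdot>\<^sub>v E 1 + \<beta> \<cdot>\<^sub>v E 2"
    using D_mat E[of 0] E[of 1]
    by (simp add: mult_add_distrib_mat_vec mult_mat_vec numeral_2_eq_2)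
  moreover have "D *\<^sub>v (\<alpha> \<cdot>\<^sub>v E 0 + \<beta> \<cdot>\<^sub>v E 1) = 0\<^sub>v n" using assms D_mat by auto
  ultimately have sum: "\<alpha> \<cdot>\<^sub>v E 1 + \<beta> \<cdot>\<^sub>v E 2 = 0\<^sub>v n" by simp
  have eq: "\<alpha> \<cdot>\<^sub>v E 1 = (- \<beta>) \<cdot>\<^sub>v E 2"
  proof (rule eq_vecI)
    fix i assume i: "i < dim_vec ((- \<beta>) \<cdot>\<^sub>v E 2)"
    then have "(\<alpha> \<cdot>\<^sub>v E 1 + \<beta> \<cdot>\<^sub>v E 2) $ i = 0" using sum E[of 2] by auto
    then show "(\<alpha> \<cdot>\<^sub>v E 1) $ i = ((- \<beta>) \<cdot>\<^sub>v E 2) $ i"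
      using i E[of 1] E[of 2] by (simp add: add_eq_0_iff2)
  qed (use E[of 1] E[of 2] in auto)
  have U_smult: "c \<cdot>\<^sub>v v \<in> U k" if "v \<in> U k" "Suc k < n" for c v k
    using complex_subspaceD(4)[OF subspace_mat_image[OF a_mat]] that by blast
  have "\<alpha> \<cdot>\<^sub>v E 1 \<in> U 0" using E_Suc_mem_U[of 0] n4 by (intro U_smult) auto
  moreover have "(- \<beta>) \<cdot>\<^sub>v E 2 \<in> U 2" using E_mem_U[of 2] n4 by (intro U_smult) auto
  ultimately have "\<alpha> \<cdot>\<^sub>v E 1 = 0\<^sub>v n" "(- \<beta>) \<cdot>\<^sub>v E 2 = 0\<^sub>v n"
    using eq U_disjoint[of 0 2] n4 by auto
  moreover have "c = 0" if "c \<cdot>\<^sub>v E j = 0\<^sub>v n" for c j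
  proof (rule ccontr)
    assume "c \<noteq> 0"
    then have "E j = inverse c \<cdot>\<^sub>v (c \<cdot>\<^sub>v E j)" by (simp add: smult_smult_assoc)
    then show False using that E_nonzero[of j] by auto
  qed
  ultimately show ?thesis by fastforce
qed

text \<open>For \<open>U 0\<close> this is the rank condition; \<open>D\<close> carries it to the other images.\<close>

lemma U_spanned:
  assumes "Suc k < n" "v \<in> U k"
  shows "\<exists>\<alpha> \<beta>. v = \<alpha> \<cdot>\<^sub>v E k + \<beta> \<cdot>\<^sub>v E (Suc k)"
  using assms
proof (induction k arbitrary: v)
  case 0
  have "vec_space.rank n (a 0) = 2" using rank by (simp add: a_def)
  then show ?case
    using rank_two_image_spanned[OF a_mat _ E_mem_U E_Suc_mem_U, of 0 v] E01_indep 0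
    by auto
next
  case (Suc k)
  have v: "v \<in> carrier_vec n" using U_carrier Suc.prems .
  define w where "w = D' *\<^sub>v v"
  have w: "w \<in> carrier_vec n" "v = D *\<^sub>v w" using v D_mat D_inv_vec by (auto simp: w_def)
  then have "w \<in> U k" using Suc.prems U_shift[of k w] by auto
  then obtain \<alpha> \<beta> where "w = \<alpha> \<cdot>\<^sub>v E k + \<beta> \<cdot>\<^sub>v E (Suc k)"
    using Suc.IH[of w] Suc.prems by auto
  then have "v = \<alpha> \<cdot>\<^sub>v E (Suc k) + \<beta> \<cdot>\<^sub>v E (Suc (Suc k))"
    using w D_mat E_carrier[of k] E_carrier[of "Suc k"]
    by (simp add: mult_add_distrib_mat_vec mult_mat_vec)
  then show ?case by blast
qed

definition P :: "complex mat" where "P = mat_of_cols n (map E [0..<n])"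

lemma P_mat: "P \<in> carrier_mat n n" using mat_of_cols_carrier(1)[of n "map E [0..<n]"] by (simp add: P_def)

lemma col_P: "j < n \<Longrightarrow> col P j = E j"
  unfolding P_def by (subst col_mat_of_cols) (auto simp: E_carrier)

lemma P_unit: "j < n \<Longrightarrow> P *\<^sub>v unit_vec n j = E j"
  using P_mat by (auto intro!: eq_vecI simp: scalar_prod_right_unit simp flip: col_P)

text \<open>The span of the \<open>E j\<close> contains every \<open>U k\<close>, so irreducibility makes it the whole space.
  Being \<open>n\<close> vectors in dimension \<open>n\<close>, they form a basis.\<close>

lemma image_P: "mat_image P = carrier_vec n"
proof -
  have sub: "VectorSpace.subspace class_ring (mat_image P) (module_vec TYPE(complex) n)"
    by (rule subspace_mat_image[OF P_mat])
  have mem: "E j \<in> mat_image P" if "j < n" for j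
    using that P_mat P_unit unfolding mat_image_def
    by (auto intro!: image_eqI[of _ _ "unit_vec n j"])
  have "U k \<subseteq> mat_image P" if "Suc k < n" for k
    using U_spanned[OF that] mem that complex_subspaceD[OF sub] by fastforce
  then have "mat_image P = {0\<^sub>v n} \<or> mat_image P = carrier_vec n"
    using sub unfolding a_def by (intro irreducible) auto
  then show ?thesis using mem[of 0] E_nonzero[of 0] n4 by auto
qed

lemma P_GL: "P \<in> carrier (GL n)"
proof -
  have "\<exists>q. \<forall>j<n. q j \<in> carrier_vec n \<and> P *\<^sub>v q j = unit_vec n j"
  proof (rule choice_iff[THEN iffD1, THEN exE])
    show "\<forall>j. \<exists>q. j < n \<longrightarrow> q \<in> carrier_vec n \<and> P *\<^sub>v q = unit_vec n j"
    proof
      fix j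
      have "unit_vec n j \<in> mat_image P" unfolding image_P by simp
      then show "\<exists>q. j < n \<longrightarrow> q \<in> carrier_vec n \<and> P *\<^sub>v q = unit_vec n j"
        using P_mat by (auto simp: mat_image_def)
    qed
  qed blast
  then obtain q where q: "\<And>j. j < n \<Longrightarrow> q j \<in> carrier_vec n \<and> P *\<^sub>v q j = unit_vec n j"
    by blast
  define Q where "Q = mat_of_cols n (map q [0..<n])"
  have Q: "Q \<in> carrier_mat n n"
    using mat_of_cols_carrier(1)[of n "map q [0..<n]"] by (simp add: Q_def)
  have "P * Q = 1\<^sub>m n"
  proof (rule mat_col_eqI)
    fix j assume "j < dim_col (1\<^sub>m n :: complex mat)"
    then have j: "j < n" by simp
    have "col Q j = q j" unfolding Q_def using j q by (subst col_mat_of_cols) auto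
    then show "col (P * Q) j = col (1\<^sub>m n) j"
      using j q col_mult2[OF P_mat Q j] by simp
  qed (use P_mat Q in auto)
  then show ?thesis
    using P_mat Q mat_mult_left_right_inverse[OF P_mat Q] by (intro GL_carrierI[of _ _ Q])
qed

section \<open>The action of the generators in this basis\<close>

lemma s_0_E_1: "\<exists>r c. s 0 *\<^sub>v E 1 = r \<cdot>\<^sub>v E 0 + c \<cdot>\<^sub>v E 1"
proof -
  have "a 0 *\<^sub>v E 1 \<in> U 0" using n4 E_carrier by (auto simp: U_iff)
  then obtain r c where "a 0 *\<^sub>v E 1 = r \<cdot>\<^sub>v E 0 + c \<cdot>\<^sub>v E 1"
    using U_spanned[of 0 "a 0 *\<^sub>v E 1"] n4 by auto
  then have "s 0 *\<^sub>v E 1 = r \<cdot>\<^sub>v E 0 + (1 + c) \<cdot>\<^sub>v E 1"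
    using n4 E_carrier[of 0] E_carrier[of 1] s_apply[of 0 "E 1"]
    by (intro eq_vecI) (simp_all add: algebra_simps)
  then show ?thesis by blast
qed

context
  fixes r c :: complex
  assumes rc: "s 0 *\<^sub>v E 1 = r \<cdot>\<^sub>v E 0 + c \<cdot>\<^sub>v E 1"
begin

lemma s_E_Suc: "Suc k < n \<Longrightarrow> s k *\<^sub>v E (Suc k) = r \<cdot>\<^sub>v E k + c \<cdot>\<^sub>v E (Suc k)"
proof (induction k)
  case 0
  then show ?case using rc by simp
next
  case (Suc k)
  have "s (Suc k) *\<^sub>v E (Suc (Suc k)) = D *\<^sub>v (s k *\<^sub>v E (Suc k))"
    using D_s_vec[of k "E (Suc k)"] Suc.prems E_carrier by simp
  also have "\<dots> = r \<cdot>\<^sub>v E (Suc k) + c \<cdot>\<^sub>v E (Suc (Suc k))"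
    using Suc D_mat E_carrier[of k] E_carrier[of "Suc k"]
    by (simp add: mult_add_distrib_mat_vec mult_mat_vec)
  finally show ?case .
qed

text \<open>Compare the two sides of the braid relation of \<open>s 0\<close> and \<open>s 1\<close> on \<open>E 2\<close>: they
  differ by a multiple of \<open>E 2\<close> alone.\<close>

lemma c_eq: "c = r * c + c * c"
proof -
  note E = E_carrier
  have m: "s 0 \<in> carrier_mat n n" "s 1 \<in> carrier_mat n n" using n4 by (auto intro: s_mat)
  have lin: "M *\<^sub>v (\<alpha> \<cdot>\<^sub>v v + \<beta> \<cdot>\<^sub>v w) = \<alpha> \<cdot>\<^sub>v (M *\<^sub>v v) + \<beta> \<cdot>\<^sub>v (M *\<^sub>v w)"
    if "M \<in> carrier_mat n n" "v \<in> carrier_vec n" "w \<in> carrier_vec n"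
    for M :: "complex mat" and v w \<alpha> \<beta>
    using that by (simp add: mult_add_distrib_mat_vec mult_mat_vec)
  have s0: "s 0 *\<^sub>v E 0 = E 1" "s 0 *\<^sub>v E 1 = r \<cdot>\<^sub>v E 0 + c \<cdot>\<^sub>v E 1" "s 0 *\<^sub>v E 2 = E 2"
    using s_E[of 0] s_E_Suc[of 0] s_fixes_E[of 0 2] n4 by auto
  have s1: "s 1 *\<^sub>v E 0 = E 0" "s 1 *\<^sub>v E 1 = E 2" "s 1 *\<^sub>v E 2 = r \<cdot>\<^sub>v E 1 + c \<cdot>\<^sub>v E 2"
    using s_fixes_E[of 1 0] s_E[of 1] s_E_Suc[of 1] n4 by (auto simp: numeral_2_eq_2)
  have "s 0 * (s 1 * s 0) = s 1 * (s 0 * s 1)" using braid[of 0] n4 by simp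
  then have "s 0 *\<^sub>v (s 1 *\<^sub>v (s 0 *\<^sub>v E 2)) = s 1 *\<^sub>v (s 0 *\<^sub>v (s 1 *\<^sub>v E 2))"
    using m E[of 2] assoc_mult_mat_vec[OF m(1) mult_carrier_mat[OF m(2,1)] E[of 2]]
      assoc_mult_mat_vec[OF m(2) mult_carrier_mat[OF m(1,2)] E[of 2]] by simp
  moreover have "s 0 *\<^sub>v (s 1 *\<^sub>v (s 0 *\<^sub>v E 2)) = r \<cdot>\<^sub>v (r \<cdot>\<^sub>v E 0 + c \<cdot>\<^sub>v E 1) + c \<cdot>\<^sub>v E 2"
    using s0 s1 lin[OF m(1)] E by simp
  moreover have "s 1 *\<^sub>v (s 0 *\<^sub>v (s 1 *\<^sub>v E 2)) =
      r \<cdot>\<^sub>v (r \<cdot>\<^sub>v E 0 + c \<cdot>\<^sub>v E 2) + c \<cdot>\<^sub>v (r \<cdot>\<^sub>v E 1 + c \<cdot>\<^sub>v E 2)"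
    using s0 s1 lin[OF m(1)] lin[OF m(2)] E by simp
  ultimately have eq: "r \<cdot>\<^sub>v (r \<cdot>\<^sub>v E 0 + c \<cdot>\<^sub>v E 1) + c \<cdot>\<^sub>v E 2 =
      r \<cdot>\<^sub>v (r \<cdot>\<^sub>v E 0 + c \<cdot>\<^sub>v E 2) + c \<cdot>\<^sub>v (r \<cdot>\<^sub>v E 1 + c \<cdot>\<^sub>v E 2)" by simp
  obtain i where i: "i < n" "E 2 $ i \<noteq> 0"
    using E_nonzero[of 2] E[of 2] by (metis eq_vecI carrier_vecD index_zero_vec)
  have dims: "dim_vec (E j) = n" for j using E[of j] by simp
  have "(r \<cdot>\<^sub>v (r \<cdot>\<^sub>v E 0 + c \<cdot>\<^sub>v E 1) + c \<cdot>\<^sub>v E 2) $ i =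
      r * (r * E 0 $ i + c * E 1 $ i) + c * E 2 $ i"
    using i(1) dims by simp
  moreover have "(r \<cdot>\<^sub>v (r \<cdot>\<^sub>v E 0 + c \<cdot>\<^sub>v E 2) + c \<cdot>\<^sub>v (r \<cdot>\<^sub>v E 1 + c \<cdot>\<^sub>v E 2)) $ i =
      r * (r * E 0 $ i + c * E 2 $ i) + c * (r * E 1 $ i + c * E 2 $ i)"
    using i(1) dims by simp
  ultimately have "c * E 2 $ i = (r * c + c * c) * E 2 $ i" using eq by (simp add: algebra_simps)
  then show ?thesis using i(2) by simp
qed

text \<open>The alternative \<open>r + c = 1\<close> belongs to the Burau representation, where \<open>s 0 - 1\<close> has
  rank one: its image is the line through \<open>E 1 - E 0\<close>. That line does not contain
  \<open>E 0\<close>, which lies in \<open>U 0\<close>.\<close>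

lemma c_zero: "c = 0"
proof (rule ccontr)
  assume "c \<noteq> 0"
  with c_eq have "c * 1 = c * (r + c)" by (simp add: algebra_simps)
  then have "1 = r + c" using \<open>c \<noteq> 0\<close> by (simp only: mult_cancel_left) simp
  then have r: "r = 1 - c" by (simp add: algebra_simps)
  define L where "L = {\<gamma> \<cdot>\<^sub>v (E 1 - E 0) | \<gamma>. True}"
  have dims: "dim_vec (E j) = n" for j using E_carrier[of j] by simp
  have L: "VectorSpace.subspace class_ring L (module_vec TYPE(complex) n)"
  proof (rule complex_subspaceI)
    show "L \<subseteq> carrier_vec n" using E_carrier by (auto simp: L_def)
    show "0\<^sub>v n \<in> L" unfolding L_def using E_carrier[of 0] E_carrier[of 1]
      by (auto intro!: exI[of _ 0] eq_vecI)
    show "v + w \<in> L" if "v \<in> L" "w \<in> L" for v w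
      using that unfolding L_def by (auto simp flip: add_smult_distrib_vec)
    show "\<gamma> \<cdot>\<^sub>v v \<in> L" if "v \<in> L" for \<gamma> v
      using that unfolding L_def by (auto simp: smult_smult_assoc)
  qed
  have col: "a 0 *\<^sub>v E j \<in> L" if "j < n" for j
  proof -
    consider "j = 0" | "j = 1" | "1 < j" by linarith
    then show ?thesis
    proof cases
      case 1
      then have "a 0 *\<^sub>v E j = 1 \<cdot>\<^sub>v (E 1 - E 0)"
        using s_E[of 0] n4 E_carrier by (simp add: a_apply)
      then show ?thesis unfolding L_def by blast
    next
      case 2
      have "a 0 *\<^sub>v E 1 = (r \<cdot>\<^sub>v E 0 + c \<cdot>\<^sub>v E 1) - E 1"
        using rc n4 E_carrier by (simp add: a_apply)
      also have "\<dots> = (c - 1) \<cdot>\<^sub>v (E 1 - E 0)"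
        unfolding r by (rule eq_vecI) (simp_all add: dims algebra_simps)
      finally have "a 0 *\<^sub>v E j = (c - 1) \<cdot>\<^sub>v (E 1 - E 0)" using 2 by simp
      then show ?thesis unfolding L_def by blast
    next
      case 3
      then have "a 0 *\<^sub>v E j = 0\<^sub>v n" using a_kills_E[of 0 j] that n4 by auto
      then show ?thesis using complex_subspaceD(2)[OF L] by simp
    qed
  qed
  have a0: "a 0 \<in> carrier_mat n n" using a_mat n4 by simp
  have "mat_image (a 0 * P) \<subseteq> L"
  proof (rule mat_image_subset_subspace[OF _ L])
    show "a 0 * P \<in> carrier_mat n n" using a0 P_mat by simp
    show "col (a 0 * P) j \<in> L" if "j < n" for j
      using col col_P that by (simp add: col_mult2[OF a0 P_mat])
  qed
  moreover have "U 0 \<subseteq> mat_image (a 0 * P)"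
  proof
    fix v assume "v \<in> U 0"
    then obtain w where w: "w \<in> carrier_vec n" "v = a 0 *\<^sub>v w" using n4 by (auto simp: U_iff)
    then have "w \<in> mat_image P" using image_P by simp
    then obtain x where "x \<in> carrier_vec n" "w = P *\<^sub>v x"
      using P_mat by (auto simp: mat_image_def)
    then show "v \<in> mat_image (a 0 * P)"
      using w a0 P_mat unfolding mat_image_def by auto
  qed
  ultimately have "E 0 \<in> L" using E_mem_U[of 0] n4 by auto
  then obtain \<gamma> where \<gamma>: "E 0 = \<gamma> \<cdot>\<^sub>v (E 1 - E 0)" by (auto simp: L_def)
  have "(1 + \<gamma>) \<cdot>\<^sub>v E 0 + (- \<gamma>) \<cdot>\<^sub>v E 1 = 0\<^sub>v n"
  proof (rule eq_vecI)
    fix i assume "i < dim_vec (0\<^sub>v n :: complex vec)"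
    then show "((1 + \<gamma>) \<cdot>\<^sub>v E 0 + (- \<gamma>) \<cdot>\<^sub>v E 1) $ i = 0\<^sub>v n $ i"
      using arg_cong[OF \<gamma>, of "\<lambda>v. v $ i"] dims by (simp add: algebra_simps)
  qed (simp add: dims)
  from E01_indep[OF this] show False by auto
qed

lemma r_nonzero: "r \<noteq> 0"
proof
  assume "r = 0"
  interpret G: group "GL n" by (rule group_GL)
  have s0: "s 0 \<in> carrier (GL n)" using s_GL n4 by simp
  define t where "t = inv\<^bsub>GL n\<^esub> s 0"
  have t: "t \<in> carrier_mat n n" "t * s 0 = 1\<^sub>m n"
    using G.l_inv[OF s0] GL_carrier_mat[OF G.inv_closed[OF s0]]
    by (simp_all only: t_def GL_simps(2,3))
  have "s 0 *\<^sub>v E 1 = 0\<^sub>v n"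
    using rc c_zero \<open>r = 0\<close> E_carrier[of 0] E_carrier[of 1] by (auto intro!: eq_vecI)
  then have "t *\<^sub>v (s 0 *\<^sub>v E 1) = 0\<^sub>v n" using t(1) by auto
  moreover have "t *\<^sub>v (s 0 *\<^sub>v E 1) = E 1"
    using t E_carrier[of 1] assoc_mult_mat_vec[OF t(1) GL_carrier_mat[OF s0] E_carrier[of 1]] by simp
  ultimately show False using E_nonzero[of 1] by simp
qed

text \<open>The columns of \<open>P\<close> are the \<open>E j\<close>, so this collects the action of \<open>s k\<close> on them.\<close>

lemma s_P:
  assumes k: "Suc k < n"
  shows "s k * P = P * standard_mat n r (Suc k)"
proof (rule mat_col_eqI)
  fix j assume "j < dim_col (P * standard_mat n r (Suc k))"
  then have j: "j < n" by (simp add: standard_mat_def)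
  have dims: "dim_vec (E j) = n" for j using E_carrier[of j] by simp
  have "col (s k * P) j = s k *\<^sub>v E j"
    using j by (simp add: col_mult2[OF s_mat[OF k] P_mat] col_P)
  also have "\<dots> = P *\<^sub>v col (standard_mat n r (Suc k)) j"
  proof -
    consider "j = k" | "j = Suc k" | "j \<noteq> k" "j \<noteq> Suc k" by blast
    then show ?thesis
    proof cases
      case 1
      then have "col (standard_mat n r (Suc k)) j = unit_vec n (Suc k)"
        using k by (auto intro!: eq_vecI simp: standard_mat_def)
      then show ?thesis using 1 k s_E P_unit by simp
    next
      case 2
      then have "col (standard_mat n r (Suc k)) j = r \<cdot>\<^sub>v unit_vec n k"
        using k by (auto intro!: eq_vecI simp: standard_mat_def)
      moreover have "s k *\<^sub>v E (Suc k) = r \<cdot>\<^sub>v E k"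
        using s_E_Suc[OF k] c_zero dims by (auto intro!: eq_vecI)
      ultimately show ?thesis
        using 2 k P_unit[of k] mult_mat_vec[OF P_mat, of "unit_vec n k" r] by simp
    next
      case 3
      then have "col (standard_mat n r (Suc k)) j = unit_vec n j"
        using k j by (auto intro!: eq_vecI simp: standard_mat_def)
      then show ?thesis using 3 k j s_fixes_E P_unit by simp
    qed
  qed
  also have "\<dots> = col (P * standard_mat n r (Suc k)) j"
    using j by (simp add: col_mult2[OF P_mat standard_mat_carrier])
  finally show "col (s k * P) j = col (P * standard_mat n r (Suc k)) j" .
qed (use s_mat[OF k] P_mat in \<open>simp_all add: standard_mat_def\<close>)

end

theorem intertwines_standard:
  "\<exists>r Q. r \<noteq> 0 \<and> Q \<in> carrier (GL n) \<and>
    (\<forall>k. Suc k < n \<longrightarrow> s k * Q = Q * standard_mat n r (Suc k))"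
proof -
  obtain r c where "s 0 *\<^sub>v E 1 = r \<cdot>\<^sub>v E 0 + c \<cdot>\<^sub>v E 1" using s_0_E_1 by blast
  from r_nonzero[OF this] s_P[OF this] P_GL show ?thesis by blast
qed

end

section \<open>Representations whose friendship graph is a chain\<close>

lemma irreducible_rep_shift_images:
  assumes irr: "irreducible_rep (braid_group n) d \<rho>"
    and W: "VectorSpace.subspace class_ring W (module_vec TYPE(complex) d)"
    and im: "\<And>i. i \<in> {1..n-1} \<Longrightarrow> mat_image (gen_shift n d \<rho> i) \<subseteq> W"
  shows "W = {0\<^sub>v d} \<or> W = carrier_vec d"
proof -
  note W_simps = complex_subspaceD[OF W]
  interpret B: group "braid_group n" unfolding braid_group_def by (rule group_presented)
  interpret G: group "GL d" by (rule group_GL)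
  have hom: "\<rho> \<in> hom (braid_group n) (GL d)"
    using irr by (simp add: irreducible_rep_def representation_def)
  interpret \<rho>: group_hom "braid_group n" "GL d" \<rho> by unfold_locales (rule hom)
  have mat: "\<rho> X \<in> carrier_mat d d" if "X \<in> carrier (braid_group n)" for X
    using that by (intro GL_carrier_mat \<rho>.hom_closed)
  have mult: "\<rho> (X \<otimes>\<^bsub>braid_group n\<^esub> Y) *\<^sub>v w = \<rho> X *\<^sub>v (\<rho> Y *\<^sub>v w)"
    if "X \<in> carrier (braid_group n)" "Y \<in> carrier (braid_group n)" "w \<in> carrier_vec d" for X Y w
    using that mat assoc_mult_mat_vec[OF mat mat] by (simp add: GL_simps(2))
  have \<rho>_one: "\<rho> \<one>\<^bsub>braid_group n\<^esub> = 1\<^sub>m d" using \<rho>.hom_one by (simp add: GL_simps(3))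
  \<comment> \<open>For \<open>A = g - 1\<close> we have \<open>g w = w + A w\<close> and \<open>g\<^sup>-\<^sup>1 w = w - A (g\<^sup>-\<^sup>1 w)\<close>,
    so a space containing the image of \<open>A\<close> is stable under \<open>g\<close> and its inverse.\<close>
  have shift: "\<rho> (braid_gen n i) *\<^sub>v w - w \<in> W" if "i \<in> {1..n-1}" "w \<in> carrier_vec d" for i w
  proof -
    have "gen_shift n d \<rho> i *\<^sub>v w \<in> mat_image (gen_shift n d \<rho> i)"
      using that by (auto simp: mat_image_def gen_shift_def)
    moreover have "gen_shift n d \<rho> i *\<^sub>v w = \<rho> (braid_gen n i) *\<^sub>v w - w"
      using minus_mult_distrib_mat_vec[OF mat[OF braid_gen_closed] one_carrier_mat that(2)] that
      by (simp add: gen_shift_def)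
    ultimately show ?thesis using im that by auto
  qed
  have stable: "\<rho> (braid_gen n i) *\<^sub>v w \<in> W" if "i \<in> {1..n-1}" "w \<in> W" for i w
  proof -
    have w: "w \<in> carrier_vec d" using that W_simps(1) by auto
    have "\<rho> (braid_gen n i) *\<^sub>v w = w + (\<rho> (braid_gen n i) *\<^sub>v w - w)"
      using w mat[OF braid_gen_closed[OF that(1)]] by (intro eq_vecI) auto
    then show ?thesis using shift[OF that(1) w] W_simps(3) that(2) by metis
  qed
  have stable_inv: "\<rho> (inv\<^bsub>braid_group n\<^esub> braid_gen n i) *\<^sub>v w \<in> W" if "i \<in> {1..n-1}" "w \<in> W" for i w
  proof -
    have w: "w \<in> carrier_vec d" using that W_simps(1) by auto
    have cl: "braid_gen n i \<in> carrier (braid_group n)" using that(1) by (rule braid_gen_closed)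
    define u where "u = \<rho> (inv\<^bsub>braid_group n\<^esub> braid_gen n i) *\<^sub>v w"
    have u: "u \<in> carrier_vec d"
      using w mat[OF B.inv_closed[OF cl]] by (simp add: u_def)
    have "\<rho> (braid_gen n i) *\<^sub>v u = w"
      using mult[OF cl B.inv_closed[OF cl] w] cl w
      by (simp add: u_def GL_simps(3))
    then have "u = w + (- 1) \<cdot>\<^sub>v (\<rho> (braid_gen n i) *\<^sub>v u - u)"
      using u w by (intro eq_vecI) auto
    moreover have "w + (- 1) \<cdot>\<^sub>v (\<rho> (braid_gen n i) *\<^sub>v u - u) \<in> W"
      using shift[OF that(1) u] W_simps(3,4) that(2) by blast
    ultimately show ?thesis by (simp add: u_def)
  qed
  have "\<forall>w\<in>W. \<rho> X *\<^sub>v w \<in> W" if "X \<in> carrier (braid_group n)" for X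
    using that unfolding braid_group_def
  proof (induction rule: presented_group_induct)
    case one
    then show ?case using W_simps(1) \<rho>_one[unfolded braid_group_def] by auto
  next
    case (gen s X)
    note X = gen(2)[folded braid_group_def]
    show ?case
    proof
      fix w assume "w \<in> W"
      then have "\<rho> (braid_gen n s) *\<^sub>v (\<rho> X *\<^sub>v w) \<in> W"
        using gen(1,3) by (intro stable) auto
      then show "\<rho> (presented_gen {1..n-1} (braid_relations n) s
          \<otimes>\<^bsub>presented_group {1..n-1} (braid_relations n)\<^esub> X) *\<^sub>v w \<in> W"
        using mult[OF braid_gen_closed[OF gen(1)] X] \<open>w \<in> W\<close> W_simps(1)
        by (auto simp: braid_gen_def braid_group_def)
    qed
  next
    case (inv s X)
    note X = inv(2)[folded braid_group_def]
    show ?case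
    proof
      fix w assume "w \<in> W"
      then have "\<rho> (inv\<^bsub>braid_group n\<^esub> braid_gen n s) *\<^sub>v (\<rho> X *\<^sub>v w) \<in> W"
        using inv(1,3) by (intro stable_inv) auto
      moreover have "\<rho> (inv\<^bsub>braid_group n\<^esub> braid_gen n s \<otimes>\<^bsub>braid_group n\<^esub> X) *\<^sub>v w =
          \<rho> (inv\<^bsub>braid_group n\<^esub> braid_gen n s) *\<^sub>v (\<rho> X *\<^sub>v w)"
        using mult[OF B.inv_closed[OF braid_gen_closed[OF inv(1)]] X] \<open>w \<in> W\<close> W_simps(1) by auto
      ultimately show "\<rho> (inv\<^bsub>presented_group {1..n-1} (braid_relations n)\<^esub>
            presented_gen {1..n-1} (braid_relations n) s
          \<otimes>\<^bsub>presented_group {1..n-1} (braid_relations n)\<^esub> X) *\<^sub>v w \<in> W"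
        by (simp only: braid_gen_def braid_group_def)
    qed
  qed
  then show ?thesis using irr W by (auto simp: irreducible_rep_def)
qed

theorem theorem5p1:
  fixes n :: nat and \<rho> :: "nat gword set \<Rightarrow> complex mat"
  assumes "n \<ge> 4"
    and "irreducible_rep (braid_group n) n \<rho>"
    and "vec_space.rank n (gen_shift n n \<rho> 1) = 2"
    and "is_chain (friendship_graph n n \<rho>)"
  shows "\<exists>u::complex. u \<noteq> 0 \<and> equivalent_reps (braid_group n) n \<rho> (standard_rep n u)"
proof -
  have hom: "\<rho> \<in> hom (braid_group n) (GL n)"
    using assms(2) by (simp add: irreducible_rep_def representation_def)
  define s where "s k = \<rho> (braid_gen n (Suc k))" for k
  have s_shift: "s k - 1\<^sub>m n = gen_shift n n \<rho> (Suc k)" for k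
    by (simp add: s_def gen_shift_def)
  have gen: "braid_gen n (Suc k) \<in> carrier (braid_group n)" if "Suc k < n" for k
    using that by (intro braid_gen_closed) simp
  have \<rho>_mult: "\<rho> (x \<otimes>\<^bsub>braid_group n\<^esub> y) = \<rho> x * \<rho> y"
    if "x \<in> carrier (braid_group n)" "y \<in> carrier (braid_group n)" for x y
    using hom_mult[OF hom that] by (simp add: GL_simps(2))
  interpret B: group "braid_group n" unfolding braid_group_def by (rule group_presented)
  have edge_iff: "mat_image (gen_shift n n \<rho> i) \<inter> mat_image (gen_shift n n \<rho> j) \<noteq> {0\<^sub>v n} \<longleftrightarrow>
      \<bar>int i - int j\<bar> = 1" if "i \<in> {1..n-1}" "j \<in> {1..n-1}" "i \<noteq> j" for i j
  proof -
    have "{i, j} \<in> snd (friendship_graph n n \<rho>) \<longleftrightarrow>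
        mat_image (gen_shift n n \<rho> i) \<inter> mat_image (gen_shift n n \<rho> j) \<noteq> {0\<^sub>v n}"
      using that unfolding friendship_graph_def by (auto simp: doubleton_eq_iff Int_commute)
    then show ?thesis
      using assms(4) that unfolding is_chain_def by (simp add: friendship_graph_def)
  qed
  have "mat_image (s 0 - 1\<^sub>m n) \<inter> mat_image (s 1 - 1\<^sub>m n) \<noteq> {0\<^sub>v n}"
    using edge_iff[of 1 2] assms(1) by (simp add: s_shift numeral_2_eq_2)
  moreover have "0\<^sub>v n \<in> mat_image (s k - 1\<^sub>m n)" for k
    using complex_subspaceD(2)[OF subspace_mat_image[OF minus_carrier_mat[OF one_carrier_mat]]] .
  ultimately obtain f where f: "f \<in> mat_image (s 0 - 1\<^sub>m n)" "f \<in> mat_image (s 1 - 1\<^sub>m n)" "f \<noteq> 0\<^sub>v n"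
    by blast
  interpret chain_generators n s f
  proof unfold_locales
    show "s k \<in> carrier (GL n)" if "Suc k < n" for k
      using hom_in_carrier[OF hom gen[OF that]] by (simp add: s_def)
    show "s k * (s (Suc k) * s k) = s (Suc k) * (s k * s (Suc k))" if "Suc (Suc k) < n" for k
      using arg_cong[OF braid_gen_braid[of "Suc k" n], of \<rho>] that gen[of k] gen[of "Suc k"]
      by (simp add: s_def \<rho>_mult)
    show "s i * s j = s j * s i" if "Suc i < j" "Suc j < n" for i j
      using arg_cong[OF braid_gen_commute[of "Suc i" n "Suc j"], of \<rho>] that gen[of i] gen[of j]
      by (simp add: s_def \<rho>_mult)
    show "vec_space.rank n (s 0 - 1\<^sub>m n) = 2" using assms(3) by (simp add: s_shift)
    show "mat_image (s i - 1\<^sub>m n) \<inter> mat_image (s j - 1\<^sub>m n) = {0\<^sub>v n}"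
      if "Suc i < j" "Suc j < n" for i j
      using edge_iff[of "Suc i" "Suc j"] that by (auto simp: s_shift)
    show "W = {0\<^sub>v n} \<or> W = carrier_vec n"
      if "VectorSpace.subspace class_ring W (module_vec TYPE(complex) n)"
        "\<And>k. Suc k < n \<Longrightarrow> mat_image (s k - 1\<^sub>m n) \<subseteq> W" for W
    proof (rule irreducible_rep_shift_images[OF assms(2) that(1)])
      fix i assume "i \<in> {1..n-1}"
      then obtain k where "i = Suc k" "Suc k < n" by (cases i) auto
      then show "mat_image (gen_shift n n \<rho> i) \<subseteq> W"
        using that(2)[of k] by (simp add: s_shift)
    qed
  qed (use assms(1) f in auto)
  obtain u Q where u: "u \<noteq> 0" and Q: "Q \<in> carrier (GL n)"
    and inter: "\<And>k. Suc k < n \<Longrightarrow> s k * Q = Q * standard_mat n u (Suc k)"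
    using intertwines_standard by blast
  have "\<rho> g = Q \<otimes>\<^bsub>GL n\<^esub> standard_rep n u g \<otimes>\<^bsub>GL n\<^esub> inv\<^bsub>GL n\<^esub> Q"
    if "g \<in> carrier (braid_group n)" for g
  proof (rule presented_conjugate_homs[OF group_GL _ _ Q])
    show "\<rho> \<in> hom (presented_group {1..n-1} (braid_relations n)) (GL n)"
      using hom by (simp add: braid_group_def)
    show "standard_rep n u \<in> hom (presented_group {1..n-1} (braid_relations n)) (GL n)"
      using standard_rep_representation[OF u, of n] by (simp add: representation_def braid_group_def)
    show "g \<in> carrier (presented_group {1..n-1} (braid_relations n))"
      using that by (simp add: braid_group_def)
    fix i assume i: "i \<in> {1..n-1}"
    then have "\<rho> (braid_gen n i) * Q = Q * standard_mat n u i"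
      using inter[of "i - 1"] by (cases i) (auto simp: s_def)
    then show "\<rho> (presented_gen {1..n-1} (braid_relations n) i) \<otimes>\<^bsub>GL n\<^esub> Q =
        Q \<otimes>\<^bsub>GL n\<^esub> standard_rep n u (presented_gen {1..n-1} (braid_relations n) i)"
      using standard_rep_gen[OF u i] by (simp add: braid_gen_def GL_simps(2))
  qed
  then show ?thesis using u Q by (auto simp: equivalent_reps_def)
qed

end
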